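(* For $a\in(0,1/2]$, $r\in(0,1)$ and $K\in(1,\infty)$, let $r_0=r^*=\sqrt[3]{1-r^3}$, let $$r_n=\frac{\sqrt[3]{9r_{n-1}(1+r_{n-1}+r_{n-1}^2)}}{1+2r_{n-1}}\quad (n\ge 1),$$ and let $\Sigma=\sum_{n=0}^\infty 3^{-n}\log\left[(1+2r_n)(1+r_n+r_n^2)\right]$. Then $$\varphi_{1/K}^*(a,r)>r^{K}\exp\left\{\frac{1-K}{3}\left(R(a)-\log 27+\Sigma\right)\right\}$$ for $a\in(0,1/3]$ and $r\in(0,1)$, and $$\varphi_{1/K}^*(a,r)>r^{K}\exp\left\{\frac{\Sigma(1-K)}{3}\right\}$$ for $a\in[1/3,1/2)$ and $r\in(0,1)$.
   Context: $F(a,b;c;x)=\sum_{n=0}^\infty \frac{(a,n)(b,n)}{(c,n)}\frac{x^n}{n!}$ is the Gaussian hypergeometric function, where $(a,n)=a(a+1)\cdots(a+n-1)$, $(a,0)=1$. For $a\in(0,1/2]$ and $r\in(0,1)$, $\mu_a^*(r)=\frac{\pi}{2\sin(\pi a)}\frac{F(a,1-a;1;1-r^3)}{F(a,1-a;1;r^3)}$, which is a decreasing homeomorphism from $(0,1)$ onto $(0,\infty)$. For $K>0$, $\varphi_K^*(a,r)=(\mu_a^* )^{-1}(\mu_a^*(r)/K)$; thus $\varphi_{1/K}^*(a,r)=(\mu_a^* )^{-1}(K\mu_a^*(r))$. $R(a)=-2\gamma-\Psi(a)-\Psi(1-a)$, where $\Psi=\Gamma'/\Gamma$ is the psi (digamma)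 function and $\gamma$ is the Euler–Mascheroni constant. *)

theory Defs
  imports "HOL-Analysis.Analysis"
begin

definition hypergeoF :: "real \<Rightarrow> real \<Rightarrow> real \<Rightarrow> real \<Rightarrow> real" where
  "hypergeoF a b c x =
     (\<Sum>n. pochhammer a n * pochhammer b n / pochhammer c n * (x ^ n / fact n))"

definition mu_star :: "real \<Rightarrow> real \<Rightarrow> real" where
  "mu_star a r =
     pi / (2 * sin (pi * a)) *
     (hypergeoF a (1 - a) 1 (1 - r ^ 3) / hypergeoF a (1 - a) 1 (r ^ 3))"

text \<open>For \<open>0 < a \<le> 1/2\<close> the function \<open>mu_star a\<close> is a decreasing bijection from the open unit
  interval onto the positive reals; the inverse below is taken with respect to that domain.\<close>

definition phi_star :: "real \<Rightarrow> real \<Rightarrow> real \<Rightarrow> real" where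
  "phi_star K a r = inv_into {0<..<1} (mu_star a) (mu_star a r / K)"

definition R_fun :: "real \<Rightarrow> real" where
  "R_fun a = - 2 * euler_mascheroni - Digamma a - Digamma (1 - a)"

fun r_seq :: "real \<Rightarrow> nat \<Rightarrow> real" where
  "r_seq r 0 = root 3 (1 - r ^ 3)"
| "r_seq r (Suc n) =
     root 3 (9 * r_seq r n * (1 + r_seq r n + (r_seq r n)\<^sup>2)) / (1 + 2 * r_seq r n)"

definition Sigma_sum :: "real \<Rightarrow> real" where
  "Sigma_sum r =
     (\<Sum>n. ln ((1 + 2 * r_seq r n) * (1 + r_seq r n + (r_seq r n)\<^sup>2)) / 3 ^ n)"

end

theory Submission
  imports Defs "HOL-Real_Asymp.Real_Asymp"
begin

text \<open>
  Put \<open>x = r\<^sup>3\<close> and \<open>F = F(a, 1 - a; 1; \<cdot>)\<close>. The second Frobenius solution at 0 of the hypergeometric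
  equation is \<open>E(x) - ln x F(x)\<close> with \<open>E(0) = R(a)\<close>, and \<open>F(1 - x)\<close> is \<open>sin (\<pi> a) / \<pi>\<close> times it; hence
  \<open>2 \<mu>(r) = M(x) = E(x) / F(x) - ln x\<close>, and the Wronskian gives \<open>M' = - 1 / (x (1 - x) F\<^sup>2)\<close>.
  From \<open>(1 - x) F\<^sup>2 < 1\<close> it follows that \<open>Q\<^sub>a(x) = M(x) + ln x\<close> is strictly decreasing with limit \<open>R(a)\<close>
  at 0; if \<open>s\<close> is the value of \<open>\<phi>\<close>, then \<open>M(s\<^sup>3) = K M(x)\<close> and \<open>s < r\<close>, so
  \<open>3 ln s = Q\<^sub>a(s\<^sup>3) - K Q\<^sub>a(x) + 3 K ln r > 3 K ln r + (1 - K) Q\<^sub>a(x)\<close>.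
  As \<open>F\<close> increases with \<open>a\<close>, the formula for \<open>M'\<close> bounds \<open>Q\<^sub>a - Q\<^sub>b\<close> (\<open>b = 1/3\<close>) by its limit
  \<open>R(a) - ln 27\<close> at 0 if \<open>a \<le> 1/3\<close>, and by its limit 0 at 1 if \<open>a \<ge> 1/3\<close>. Finally, for \<open>a = 1/3\<close>
  Ramanujan's cubic transformation shows that \<open>Q\<^sub>b(x)\<close> is the sum \<open>\<Sigma>\<close>.
\<close>

subsection \<open>Power series\<close>

lemma summable_powser_bounded:
  fixes e :: "nat \<Rightarrow> real"
  assumes "\<And>n. \<bar>e n\<bar> \<le> B" "\<bar>x\<bar> < 1"
  shows "summable (\<lambda>n. e n * x ^ n)"
proof (rule summable_comparison_test')
  show "summable (\<lambda>n. B * \<bar>x\<bar> ^ n)"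
    using assms(2) by (intro summable_mult summable_geometric) auto
  show "norm (e n * x ^ n) \<le> B * \<bar>x\<bar> ^ n" for n
    using assms(1)[of n] by (auto simp: abs_mult power_abs intro!: mult_right_mono)
qed

text \<open>With parameters \<open>a\<close>, \<open>1 - a\<close> and 1 the hypergeometric equation
  reads (x (1 - x) y')' = a (1 - a) y. The last claim expands the left side for a power series, so
  that a differential equation becomes a recurrence between coefficients. Bounded coefficients give
  radius of convergence at least 1.\<close>

lemma powser_hypergeometric_operator:
  fixes e :: "nat \<Rightarrow> real"
  assumes bdd: "\<And>n. \<bar>e n\<bar> \<le> B" and x: "\<bar>x\<bar> < 1"
  defines "P \<equiv> \<lambda>x. \<Sum>n. e n * x ^ n" and "P' \<equiv> \<lambda>x. \<Sum>n. diffs e n * x ^ n"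
  shows "(P has_real_derivative P' x) (at x)"
    and "(\<lambda>n. diffs e n * x ^ n) sums P' x"
    and "(\<lambda>n. real n * e n * x ^ n) sums (x * P' x)"
    and "\<exists>D. ((\<lambda>x. x * (1 - x) * P' x) has_real_derivative D) (at x) \<and>
             (\<lambda>n. ((real n + 1)\<^sup>2 * e (Suc n) - real n * (real n + 1) * e n) * x ^ n) sums D"
proof -
  have sm: "summable (\<lambda>n. e n * y ^ n)" if "norm y < 1" for y :: real
    using summable_powser_bounded[of e B y] bdd that by auto
  have sm': "summable (\<lambda>n. diffs e n * y ^ n)" if "norm y < 1" for y :: real
    using termdiff_converges[OF that sm] .
  have sm'': "summable (\<lambda>n. diffs (diffs e) n * y ^ n)" if "norm y < 1" for y :: real
    using termdiff_converges[OF that sm'] .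
  define P'' where "P'' = (\<lambda>x. \<Sum>n. diffs (diffs e) n * x ^ n)"
  have nx: "norm x < 1" using x by simp
  show "(P has_real_derivative P' x) (at x)"
    unfolding P_def P'_def by (rule termdiffs_strong'[OF sm nx])
  show s1: "(\<lambda>n. diffs e n * x ^ n) sums P' x"
    unfolding P'_def by (rule summable_sums[OF sm'[OF nx]])
  have s3: "(\<lambda>n. diffs (diffs e) n * x ^ n) sums P'' x"
    unfolding P''_def by (rule summable_sums[OF sm''[OF nx]])
  have d: "(P' has_real_derivative P'' x) (at x)"
    unfolding P''_def P'_def by (rule termdiffs_strong'[OF sm' nx])
  \<comment> \<open>In this and the next two series the polynomial factor vanishes at index 0, so
    shifting the index leaves no boundary term.\<close>
  have "(\<lambda>n. real (Suc n) * e (Suc n) * x ^ Suc n) sums (x * P' x)"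
    using sums_mult[OF s1, of x] by (simp add: diffs_def mult_ac)
  then show s2: "(\<lambda>n. real n * e n * x ^ n) sums (x * P' x)"
    using sums_Suc_iff[of "\<lambda>n. real n * e n * x ^ n"] by simp
  have "(\<lambda>n. real (Suc n) * (real (Suc n) + 1) * e (Suc (Suc n)) * x ^ Suc n) sums (x * P'' x)"
    using sums_mult[OF s3, of x] by (simp add: diffs_def mult_ac add_ac)
  then have s4: "(\<lambda>n. real n * (real n + 1) * e (Suc n) * x ^ n) sums (x * P'' x)"
    using sums_Suc_iff[of "\<lambda>n. real n * (real n + 1) * e (Suc n) * x ^ n"] by simp
  have "(\<lambda>n. (real (Suc n) - 1) * real (Suc n) * e (Suc n) * x ^ Suc n) sums (x * (x * P'' x))"
    using sums_mult[OF s4, of x] by (simp add: mult_ac add_ac)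
  then have s5: "(\<lambda>n. (real n - 1) * real n * e n * x ^ n) sums (x * (x * P'' x))"
    using sums_Suc_iff[of "\<lambda>n. (real n - 1) * real n * e n * x ^ n"] by simp
  define D where "D = (1 - 2 * x) * P' x + x * (1 - x) * P'' x"
  have "((\<lambda>x. x * (1 - x) * P' x) has_real_derivative D) (at x)"
    unfolding D_def by (rule derivative_eq_intros d refl)+ (simp add: algebra_simps)
  moreover have "(\<lambda>n. ((real n + 1)\<^sup>2 * e (Suc n) - real n * (real n + 1) * e n) * x ^ n) sums D"
  proof -
    have "(\<lambda>n. diffs e n * x ^ n - 2 * (real n * e n * x ^ n)
            + (real n * (real n + 1) * e (Suc n) * x ^ n - (real n - 1) * real n * e n * x ^ n)) sums
          (P' x - 2 * (x * P' x) + (x * P'' x - x * (x * P'' x)))"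
      by (intro sums_add sums_diff sums_mult s1 s2 s4 s5)
    moreover have "P' x - 2 * (x * P' x) + (x * P'' x - x * (x * P'' x)) = D"
      by (simp add: D_def algebra_simps)
    moreover have "diffs e n * x ^ n - 2 * (real n * e n * x ^ n)
            + (real n * (real n + 1) * e (Suc n) * x ^ n - (real n - 1) * real n * e n * x ^ n)
          = ((real n + 1)\<^sup>2 * e (Suc n) - real n * (real n + 1) * e n) * x ^ n" for n
      by (simp add: diffs_def algebra_simps power2_eq_square)
    ultimately show ?thesis by simp
  qed
  ultimately show "\<exists>D. ((\<lambda>x. x * (1 - x) * P' x) has_real_derivative D) (at x) \<and>
             (\<lambda>n. ((real n + 1)\<^sup>2 * e (Suc n) - real n * (real n + 1) * e n) * x ^ n) sums D"
    by blast
qed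

text \<open>The quotient is an average of the \<open>u n\<close> with weights
  \<open>b n * y ^ n\<close>. The total weight tends to infinity, so any finite set of indices
  becomes negligible and only the limit of \<open>u\<close> counts.\<close>

lemma abelian_ratio_limit:
  fixes b u :: "nat \<Rightarrow> real"
  assumes b: "\<And>n. b n \<ge> 0"
    and sm: "\<And>y. 0 < y \<Longrightarrow> y < 1 \<Longrightarrow> summable (\<lambda>n. b n * y ^ n)"
    and u: "u \<longlonglongrightarrow> L"
    and top: "filterlim (\<lambda>y. \<Sum>n. b n * y ^ n) at_top (at_left 1)"
  shows "((\<lambda>y. (\<Sum>n. u n * b n * y ^ n) / (\<Sum>n. b n * y ^ n)) \<longlongrightarrow> L) (at_left 1)"
proof (rule tendstoI)
  fix \<epsilon> :: real assume "\<epsilon> > 0"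
  obtain C where C: "\<And>n. \<bar>u n\<bar> \<le> C"
    using convergent_imp_Bseq[of u] u by (auto simp: convergent_def Bseq_def)
  obtain N where N: "\<And>n. n \<ge> N \<Longrightarrow> \<bar>u n - L\<bar> < \<epsilon> / 2"
    using tendstoD[OF u, of "\<epsilon> / 2"] \<open>\<epsilon> > 0\<close> by (auto simp: eventually_sequentially dist_real_def)
  \<comment> \<open>\<open>A\<close> bounds the contribution of the first \<open>N\<close> terms
    uniformly in \<open>y\<close>; a total weight above \<open>2 * A / \<epsilon>\<close> pushes it
    below half of the tolerance.\<close>
  define A where "A = (\<Sum>n<N. \<bar>u n - L\<bar> * b n)"
  have A0: "A \<ge> 0" unfolding A_def using b by (intro sum_nonneg) auto
  have "eventually (\<lambda>y. (\<Sum>n. b n * y ^ n) > 2 * A / \<epsilon>) (at_left 1)"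
    using top by (simp add: filterlim_at_top_dense)
  moreover have "eventually (\<lambda>y::real. y \<in> {0<..<1}) (at_left 1)"
    by (rule eventually_at_left_real) simp
  ultimately show "eventually (\<lambda>y. dist ((\<Sum>n. u n * b n * y ^ n) / (\<Sum>n. b n * y ^ n)) L < \<epsilon>) (at_left 1)"
  proof eventually_elim
    case (elim y)
    then have y: "0 < y" "y < 1" by auto
    define By where "By = (\<Sum>n. b n * y ^ n)"
    have By: "By > 2 * A / \<epsilon>" using elim by (simp add: By_def)
    have "2 * A / \<epsilon> \<ge> 0" using A0 \<open>\<epsilon> > 0\<close> by simp
    with By have By0: "By > 0" by linarith
    note sb = sm[OF y]
    have su: "summable (\<lambda>n. u n * b n * y ^ n)"
    proof (rule summable_comparison_test')
      show "summable (\<lambda>n. C * (b n * y ^ n))" using sb by (rule summable_mult)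
      show "norm (u n * b n * y ^ n) \<le> C * (b n * y ^ n)" for n
        using C[of n] b[of n] y by (auto simp: abs_mult mult.assoc intro!: mult_right_mono)
    qed
    have sf: "summable (\<lambda>n. (if n \<in> {..<N} then \<bar>u n - L\<bar> * b n else 0))"
      by (rule sums_summable[OF sums_If_finite_set]) simp
    have "(\<Sum>n. u n * b n * y ^ n) - L * By = (\<Sum>n. u n * b n * y ^ n - L * (b n * y ^ n))"
      unfolding By_def by (subst suminf_diff[symmetric]) (use su sb in \<open>auto intro: summable_mult simp: suminf_mult\<close>)
    also have "\<bar>\<dots>\<bar> \<le> (\<Sum>n. (if n \<in> {..<N} then \<bar>u n - L\<bar> * b n else 0) + \<epsilon> / 2 * (b n * y ^ n))"
    proof -
      have le: "norm (u n * b n * y ^ n - L * (b n * y ^ n)) \<le>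
        (if n \<in> {..<N} then \<bar>u n - L\<bar> * b n else 0) + \<epsilon> / 2 * (b n * y ^ n)" for n
      proof -
        have eq: "norm (u n * b n * y ^ n - L * (b n * y ^ n)) = \<bar>u n - L\<bar> * b n * y ^ n"
        proof -
          have "u n * b n * y ^ n - L * (b n * y ^ n) = (u n - L) * (b n * y ^ n)"
            by (simp add: algebra_simps)
          then show ?thesis using b[of n] y by (simp add: abs_mult)
        qed
        show ?thesis
        proof (cases "n < N")
          case True
          have "\<bar>u n - L\<bar> * b n * y ^ n \<le> \<bar>u n - L\<bar> * b n"
            using b[of n] y by (intro mult_left_le power_le_one) auto
          moreover have "0 \<le> \<epsilon> / 2 * (b n * y ^ n)" using b[of n] y \<open>\<epsilon> > 0\<close> by simp
          ultimately show ?thesis unfolding eq using True by simp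
        next
          case False
          then have "\<bar>u n - L\<bar> * (b n * y ^ n) \<le> \<epsilon> / 2 * (b n * y ^ n)"
            using N[of n] b[of n] y by (intro mult_right_mono) auto
          then show ?thesis unfolding eq using False by (simp add: mult.assoc)
        qed
      qed
      show ?thesis
        using norm_suminf_le[OF le summable_add[OF sf summable_mult[OF sb]]]
        by (simp only: real_norm_def) 
    qed
    also have "\<dots> = A + \<epsilon> / 2 * By"
      unfolding By_def A_def
      by (intro sums_unique[symmetric] sums_add sums_mult sums_If_finite_set summable_sums[OF sb]) simp
    also have "\<dots> < \<epsilon> * By" using By \<open>\<epsilon> > 0\<close> by (simp add: field_simps)
    finally have "\<bar>(\<Sum>n. u n * b n * y ^ n) - L * By\<bar> < \<epsilon> * By" .
    moreover have "(\<Sum>n. u n * b n * y ^ n) / By - L = ((\<Sum>n. u n * b n * y ^ n) - L * By) / By"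
      using By0 by (simp add: field_simps)
    ultimately show ?case using By0
      by (simp add: dist_real_def flip: By_def) (simp add: field_simps)
  qed
qed

text \<open>Since \<open>inverse 0 = 0\<close>, the term of index 0 vanishes and the sum is the
  usual series from 1 on.\<close>

lemma neg_ln_one_minus_sums:
  fixes y :: real
  assumes "0 \<le> y" "y < 1"
  shows "(\<lambda>n. inverse (real n) * y ^ n) sums (- ln (1 - y))"
  using sums_minus[OF ln_series'[of "- y"]] assms by (simp add: field_simps)

subsection \<open>Wronskians and the hypergeometric equation\<close>

text \<open>The self-adjoint form (p y')' = q y on the unit interval. The derivative is carried as a
  function of its own, so that only the product \<open>p t * y' t\<close> is differentiated and no
  second derivative appears.\<close>

definition sl_solution ::
    "(real \<Rightarrow> real) \<Rightarrow> (real \<Rightarrow> real) \<Rightarrow> (real \<Rightarrow> real) \<Rightarrow> (real \<Rightarrow> real) \<Rightarrow> bool" where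
  "sl_solution p q y y' \<longleftrightarrow>
     (\<forall>x\<in>{0<..<1}. (y has_real_derivative y' x) (at x) \<and>
                    ((\<lambda>t. p t * y' t) has_real_derivative q x * y x) (at x))"

text \<open>Abel's identity: in the derivative of y (p z') - z (p y') the products of first
  derivatives cancel, and so do the two terms with \<open>q\<close>.\<close>

lemma sl_wronskian_const:
  assumes "sl_solution p q y y'" "sl_solution p q z z'" "x \<in> {0<..<1}" "t \<in> {0<..<1}"
  shows "p x * (y x * z' x - z x * y' x) = p t * (y t * z' t - z t * y' t)"
proof -
  define W where "W = (\<lambda>x. y x * (p x * z' x) - z x * (p x * y' x))"
  have "(W has_real_derivative 0) (at u)" if "u \<in> {0<..<1}" for u
  proof -
    have d: "(y has_real_derivative y' u) (at u)" "(z has_real_derivative z' u) (at u)"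
      "((\<lambda>t. p t * y' t) has_real_derivative q u * y u) (at u)"
      "((\<lambda>t. p t * z' t) has_real_derivative q u * z u) (at u)"
      using assms(1,2) that by (auto simp: sl_solution_def)
    show ?thesis unfolding W_def
      by (rule DERIV_cong[OF DERIV_diff[OF DERIV_mult[OF d(1,4)] DERIV_mult[OF d(2,3)]]])
         (simp add: algebra_simps)
  qed
  from DERIV_isconst3[OF zero_less_one assms(3,4) this] show ?thesis
    by (simp add: W_def algebra_simps)
qed

text \<open>This evaluates the constant at the singular point 0, where the local behaviour of the
  solutions is known.\<close>

lemma sl_wronskian_limit:
  assumes "sl_solution p q y y'" "sl_solution p q z z'" "x \<in> {0<..<1}"
    and "((\<lambda>t. p t * (y t * z' t - z t * y' t)) \<longlongrightarrow> C) (at_right 0)"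
  shows "p x * (y x * z' x - z x * y' x) = C"
proof -
  have "eventually (\<lambda>t::real. t \<in> {0<..<1}) (at_right 0)"
    by (rule eventually_at_right_real) simp
  then have "eventually (\<lambda>t. p t * (y t * z' t - z t * y' t) = p x * (y x * z' x - z x * y' x)) (at_right 0)"
    by eventually_elim (use sl_wronskian_const[OF assms(1,2) _ assms(3)] in blast)
  then have "((\<lambda>t. p t * (y t * z' t - z t * y' t)) \<longlongrightarrow> p x * (y x * z' x - z x * y' x)) (at_right 0)"
    by (rule tendsto_eventually)
  with assms(4) show ?thesis by (intro tendsto_unique[of "at_right (0::real)"]) auto
qed

text \<open>With \<open>C = 0\<close> it shows that two solutions are proportional; with
  \<open>C = - 1\<close> it gives the derivative of the modulus.\<close>

lemma quotient_has_derivative_wronskian: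
  fixes y z :: "real \<Rightarrow> real" and p :: real
  assumes "(y has_real_derivative y') (at x)" "(z has_real_derivative z') (at x)"
    and "p * (y x * z' - z x * y') = C" "p \<noteq> 0" "y x \<noteq> 0"
  shows "((\<lambda>x. z x / y x) has_real_derivative C / (p * (y x)\<^sup>2)) (at x)"
proof -
  have "((\<lambda>x. z x / y x) has_real_derivative (z' * y x - z x * y') / (y x * y x)) (at x)"
    by (intro DERIV_divide assms)
  moreover have "(z' * y x - z x * y') / (y x * y x) = C / (p * (y x)\<^sup>2)"
    unfolding assms(3)[symmetric] using assms(4) by (simp add: power2_eq_square mult_ac)
  ultimately show ?thesis by simp
qed

section \<open>Coefficients, size and differential equation of F(a, 1 - a; 1; x)\<close>

definition hyp_coeff :: "real \<Rightarrow> nat \<Rightarrow> real" where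
  "hyp_coeff a n = pochhammer a n * pochhammer (1 - a) n / (fact n)\<^sup>2"

abbreviation hyF :: "real \<Rightarrow> real \<Rightarrow> real" where
  "hyF a x \<equiv> hypergeoF a (1 - a) 1 x"

definition hyF' :: "real \<Rightarrow> real \<Rightarrow> real" where
  "hyF' a x = (\<Sum>n. diffs (hyp_coeff a) n * x ^ n)"

lemma hyF_eq: "hyF a = (\<lambda>x. \<Sum>n. hyp_coeff a n * x ^ n)"
  by (simp add: hypergeoF_def hyp_coeff_def pochhammer_fact [symmetric] power2_eq_square mult_ac)

lemma hyp_coeff_0 [simp]: "hyp_coeff a 0 = 1"
  by (simp add: hyp_coeff_def)

lemma hyp_coeff_Suc:
  "hyp_coeff a (Suc n) = (a + real n) * (1 - a + real n) / (real n + 1)\<^sup>2 * hyp_coeff a n"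
  by (simp add: hyp_coeff_def pochhammer_Suc power2_eq_square divide_simps) (simp add: algebra_simps)

lemma hyp_coeff_rec:
  "(real n + 1)\<^sup>2 * hyp_coeff a (Suc n) = (real n * (real n + 1) + a * (1 - a)) * hyp_coeff a n"
proof -
  have "(real n + 1)\<^sup>2 \<noteq> 0" by simp
  then have "(real n + 1)\<^sup>2 * hyp_coeff a (Suc n) = (a + real n) * (1 - a + real n) * hyp_coeff a n"
    by (simp add: hyp_coeff_Suc)
  then show ?thesis by (simp add: algebra_simps)
qed

lemma mult_one_minus_le_quarter: "a * (1 - a) \<le> (1/4 :: real)"
  using zero_le_power2[of "a - 1/2"] by (simp add: power2_eq_square algebra_simps)

lemma hyp_coeff_pos: "0 < a \<Longrightarrow> a < 1 \<Longrightarrow> hyp_coeff a n > 0"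
  unfolding hyp_coeff_def by (intro divide_pos_pos mult_pos_pos pochhammer_pos) auto

text \<open>The right side is the coefficient of (1 - x)^(-1/2). The induction step compares ratios:
  a (1 - a) <= 1/4 <= (n + 1)/2 gives n (n + 1) + a (1 - a) <= (n + 1/2) (n + 1).\<close>

lemma hyp_coeff_le_half:
  assumes "0 < a" "a < 1"
  shows "hyp_coeff a n \<le> pochhammer (1/2) n / fact n"
proof (induction n)
  case (Suc n)
  have "(real n + 1)\<^sup>2 * hyp_coeff a (Suc n) \<le> ((real n + 1/2) * (real n + 1)) * hyp_coeff a n"
    unfolding hyp_coeff_rec
    using mult_one_minus_le_quarter[of a] hyp_coeff_pos[OF assms, of n]
    by (intro mult_right_mono) (auto simp: algebra_simps add_divide_distrib)
  also have "\<dots> \<le> ((real n + 1/2) * (real n + 1)) * (pochhammer (1/2) n / fact n)"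
    using Suc by (intro mult_left_mono) auto
  also have "\<dots> = (real n + 1)\<^sup>2 * (pochhammer (1/2) (Suc n) / fact (Suc n))"
  proof -
    have "h * s * (p / f) = s\<^sup>2 * (p * h / (s * f))" if "s \<noteq> 0" for h s p f :: real
      using that by (simp add: power2_eq_square)
    from this[of "real (Suc n)" "1/2 + real n" "pochhammer (1/2) n" "fact n"]
    show ?thesis by (simp add: pochhammer_Suc add_ac)
  qed
  finally show ?case by (rule mult_left_le_imp_le) simp
qed simp

lemma hyp_coeff_le_1:
  assumes "0 < a" "a < 1"
  shows "\<bar>hyp_coeff a n\<bar> \<le> 1"
proof -
  have "pochhammer (1/2::real) n \<le> pochhammer 1 n"
    unfolding pochhammer_prod by (intro prod_mono) auto
  then have "pochhammer (1/2) n / fact n \<le> (1::real)"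
    by (simp add: divide_le_eq_1 pochhammer_fact [symmetric])
  with hyp_coeff_le_half[OF assms, of n] hyp_coeff_pos[OF assms, of n] show ?thesis
    by linarith
qed

text \<open>The recurrence involves the parameter only through a (1 - a), which increases up to
  1/2.\<close>

lemma hyp_coeff_mono:
  assumes "0 < a" "a \<le> b" "b \<le> 1/2"
  shows "hyp_coeff a n \<le> hyp_coeff b n"
proof (induction n)
  case (Suc n)
  have "0 \<le> (b - a) * (1 - a - b)" using assms by (intro mult_nonneg_nonneg) auto
  then have "a * (1 - a) \<le> b * (1 - b)" by (simp add: algebra_simps)
  then have "(real n + 1)\<^sup>2 * hyp_coeff a (Suc n) \<le> (real n + 1)\<^sup>2 * hyp_coeff b (Suc n)"
    unfolding hyp_coeff_rec using Suc assms hyp_coeff_pos[of a n]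
    by (intro mult_mono) auto
  then show ?case by (rule mult_left_le_imp_le) simp
qed simp

text \<open>From n = 1 on, n times the coefficient does not decrease, and it starts at a (1 - a).
  Comparison with the series of -ln (1 - x) then shows that \<open>hyF a\<close> is unbounded at
  1.\<close>

lemma hyp_coeff_ge:
  assumes "0 < a" "a < 1"
  shows "a * (1 - a) * inverse (real n) \<le> hyp_coeff a n"
proof -
  have *: "a * (1 - a) \<le> real (Suc n) * hyp_coeff a (Suc n)" for n
  proof (induction n)
    case 0
    show ?case by (simp add: hyp_coeff_def)
  next
    case (Suc n)
    have "(real (Suc n) + 1) * (real (Suc n) * hyp_coeff a (Suc n))
          \<le> (real (Suc n) * (real (Suc n) + 1) + a * (1 - a)) * hyp_coeff a (Suc n)"
      using hyp_coeff_pos[OF assms, of "Suc n"] assms by (simp add: algebra_simps)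
    also have "\<dots> = (real (Suc n) + 1) * (real (Suc (Suc n)) * hyp_coeff a (Suc (Suc n)))"
      unfolding hyp_coeff_rec[symmetric] by (simp add: power2_eq_square)
    finally have "real (Suc n) * hyp_coeff a (Suc n) \<le> real (Suc (Suc n)) * hyp_coeff a (Suc (Suc n))"
      by (rule mult_left_le_imp_le) simp
    with Suc show ?case by linarith
  qed
  show ?thesis
  proof (cases n)
    case (Suc m)
    then show ?thesis using *[of m] by (simp add: field_simps)
  qed simp
qed

text \<open>Gauss's limit for 1/Gamma at \<open>a\<close> and at \<open>1 - a\<close>, combined with
  Euler's reflection formula. This limit later fixes the constant in
  \<open>hyF_flip\<close>.\<close>

lemma hyp_coeff_asymp:
  assumes "0 < a" "a < 1"
  shows "(\<lambda>n. real n * hyp_coeff a n) \<longlonglongrightarrow> sin (pi * a) / pi"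
proof -
  have "complex_of_real (rGamma a * rGamma (1 - a)) = complex_of_real (sin (pi * a) / pi)"
    using rGamma_reflection_complex[of "complex_of_real a"]
    by (simp add: rGamma_complex_of_real[symmetric] sin_of_real[symmetric])
  then have rG: "rGamma a * rGamma (1 - a) = sin (pi * a) / pi"
    by (simp only: of_real_eq_iff)
  \<comment> \<open>The two powers of n in the Gamma series multiply to n; the extra factor n / (n +
    1) replaces this n by n + 1, so that the product is exactly n + 1 times the coefficient of index
    n + 1.\<close>
  have "(\<lambda>n. rGamma_series a n * rGamma_series (1 - a) n * (real n / real (Suc n)))
          \<longlonglongrightarrow> rGamma a * rGamma (1 - a) * 1"
    by (intro tendsto_mult rGamma_series_LIMSEQ LIMSEQ_n_over_Suc_n)
  moreover have "eventually (\<lambda>n. rGamma_series a n * rGamma_series (1 - a) n * (real n / real (Suc n))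
      = real (Suc n) * hyp_coeff a (Suc n)) sequentially"
    using eventually_gt_at_top[of 0]
  proof eventually_elim
    case (elim n)
    have "exp (a * ln (real n)) * exp ((1 - a) * ln (real n)) = real n"
      using elim by (simp add: exp_add[symmetric] algebra_simps)
    then have "rGamma_series a n * rGamma_series (1 - a) n
        = pochhammer a (Suc n) * pochhammer (1 - a) (Suc n) / ((fact n)\<^sup>2 * real n)"
      by (simp add: rGamma_series_def power2_eq_square mult_ac)
    moreover have "A / (f\<^sup>2 * m) * (m / s) = s * (A / (s * f)\<^sup>2)"
      if "m \<noteq> 0" "s \<noteq> 0" for A f m s :: real
      using that by (simp add: power2_eq_square)
    ultimately show ?case using elim
      unfolding hyp_coeff_def fact_Suc of_nat_mult by (simp only: of_nat_0_less_iff of_nat_eq_0_iff)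
  qed
  ultimately have "(\<lambda>n. real (Suc n) * hyp_coeff a (Suc n)) \<longlonglongrightarrow> sin (pi * a) / pi"
    using rG by (simp add: tendsto_cong)
  then show ?thesis by (rule LIMSEQ_imp_Suc)
qed

lemma summable_hyp_coeff:
  assumes "0 < a" "a < 1" "\<bar>x\<bar> < 1"
  shows "summable (\<lambda>n. hyp_coeff a n * x ^ n)"
  using summable_powser_bounded[where e = "hyp_coeff a", OF hyp_coeff_le_1[OF assms(1,2)] assms(3)] .

lemma hyF_0 [simp]: "hyF a 0 = 1"
  unfolding hyF_eq powser_zero by simp

lemma hyF_ge_1:
  assumes "0 < a" "a < 1" "0 \<le> x" "x < 1"
  shows "hyF a x \<ge> 1"
proof -
  have "(\<Sum>n\<in>{0}. hyp_coeff a n * x ^ n) \<le> hyF a x" unfolding hyF_eq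
    using assms summable_hyp_coeff[of a x] hyp_coeff_pos[of a] 
    by (intro sum_le_suminf) (auto intro!: mult_nonneg_nonneg less_imp_le[OF hyp_coeff_pos])
  then show ?thesis by simp
qed

lemma hyF_mono:
  assumes "0 < a" "a \<le> b" "b \<le> 1/2" "0 \<le> x" "x < 1"
  shows "hyF a x \<le> hyF b x"
  unfolding hyF_eq
  by (rule suminf_le) (use assms in \<open>auto intro!: mult_right_mono hyp_coeff_mono summable_hyp_coeff\<close>)

text \<open>Coefficientwise comparison with (1 - x)^(-1/2), strict at index 1, where the
  coefficients are at most 1/4 and exactly 1/2.\<close>

lemma hyF_less:
  assumes "0 < a" "a < 1" "0 < x" "x < 1"
  shows "(1 - x) * (hyF a x)\<^sup>2 < 1"
proof -
  have "(\<lambda>n. ((- 1 / 2) gchoose n) * (- x) ^ n) sums (1 + - x) powr (- 1 / 2)"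
    by (rule gen_binomial_real) (use assms in auto)
  moreover have "((- 1 / 2) gchoose n) * (- x) ^ n = pochhammer (1/2) n / fact n * x ^ n" for n
    by (simp add: gbinomial_pochhammer power_minus[of x] mult_ac)
  ultimately have q: "(\<lambda>n. pochhammer (1/2) n / fact n * x ^ n) sums (1 - x) powr (- 1 / 2)"
    by simp
  have f: "(\<lambda>n. hyp_coeff a n * x ^ n) sums hyF a x"
    unfolding hyF_eq by (rule summable_sums[OF summable_hyp_coeff]) (use assms in auto)
  let ?g = "\<lambda>n. pochhammer (1/2) n / fact n * x ^ n - hyp_coeff a n * x ^ n"
  have g: "?g sums ((1 - x) powr (- 1 / 2) - hyF a x)"
    by (rule sums_diff[OF q f])
  have "0 < suminf ?g"
  proof (rule suminf_pos2)
    show "summable ?g" using g by (rule sums_summable)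
    show "0 \<le> ?g n" for n
      using mult_right_mono[OF hyp_coeff_le_half[OF assms(1,2), of n], of "x ^ n"] assms by simp
    have "hyp_coeff a 1 \<le> 1/4" using mult_one_minus_le_quarter[of a] by (simp add: hyp_coeff_def)
    then show "0 < ?g 1" using assms by simp
  qed
  then have lt: "hyF a x < (1 - x) powr (- 1 / 2)" using sums_unique[OF g] by simp
  have "hyF a x > 0" using hyF_ge_1[of a x] assms by simp
  with lt have "(hyF a x)\<^sup>2 < ((1 - x) powr (- 1 / 2))\<^sup>2"
    by (intro power_strict_mono) auto
  also have "\<dots> = inverse (1 - x)"
    using assms by (simp add: powr_power powr_neg_one inverse_eq_divide)
  finally show ?thesis using assms by (simp add: field_simps)
qed

lemma filterlim_neg_ln_one_minus: "filterlim (\<lambda>x::real. - ln (1 - x)) at_top (at_left 1)"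
  by real_asymp

lemma filterlim_hyF_at_left_1:
  assumes "0 < a" "a < 1"
  shows "filterlim (hyF a) at_top (at_left 1)"
proof (rule filterlim_at_top_mono)
  show "filterlim (\<lambda>x. a * (1 - a) * (- ln (1 - x))) at_top (at_left 1)"
    using assms by (intro filterlim_tendsto_pos_mult_at_top[OF tendsto_const] filterlim_neg_ln_one_minus) auto
  have "eventually (\<lambda>x::real. x \<in> {0<..<1}) (at_left 1)"
    by (rule eventually_at_left_real) simp
  then show "eventually (\<lambda>x. a * (1 - a) * (- ln (1 - x)) \<le> hyF a x) (at_left 1)"
  proof eventually_elim
    case (elim x)
    have "(\<lambda>n. a * (1 - a) * (inverse (real n) * x ^ n)) sums (a * (1 - a) * (- ln (1 - x)))"
      using elim by (intro sums_mult neg_ln_one_minus_sums) auto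
    moreover have "(\<lambda>n. hyp_coeff a n * x ^ n) sums hyF a x"
      unfolding hyF_eq by (rule summable_sums[OF summable_hyp_coeff]) (use assms elim in auto)
    ultimately show ?case
      by (rule sums_le[rotated]) (use mult_right_mono[OF hyp_coeff_ge[OF assms]] elim in \<open>auto simp: mult.assoc\<close>)
  qed
qed

lemma hyF_has_derivative:
  assumes "0 < a" "a < 1" "\<bar>x\<bar> < 1"
  shows "(hyF a has_real_derivative hyF' a x) (at x)"
  using powser_hypergeometric_operator(1)[where e = "hyp_coeff a", OF hyp_coeff_le_1[OF assms(1,2)] assms(3)]
  by (simp add: hyF_eq hyF'_def)

lemma hyF_ode:
  assumes "0 < a" "a < 1" "\<bar>x\<bar> < 1"
  shows "((\<lambda>x. x * (1 - x) * hyF' a x) has_real_derivative a * (1 - a) * hyF a x) (at x)"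
proof -
  from powser_hypergeometric_operator(4)[where e = "hyp_coeff a", OF hyp_coeff_le_1[OF assms(1,2)] assms(3)]
  obtain D where D: "((\<lambda>x. x * (1 - x) * hyF' a x) has_real_derivative D) (at x)"
    "(\<lambda>n. ((real n + 1)\<^sup>2 * hyp_coeff a (Suc n) - real n * (real n + 1) * hyp_coeff a n) * x ^ n) sums D"
    unfolding hyF'_def by blast
  have "(\<lambda>n. a * (1 - a) * (hyp_coeff a n * x ^ n)) sums D"
    using D(2) unfolding hyp_coeff_rec by (simp add: algebra_simps)
  moreover have "(\<lambda>n. a * (1 - a) * (hyp_coeff a n * x ^ n)) sums (a * (1 - a) * hyF a x)"
    unfolding hyF_eq by (intro sums_mult summable_sums summable_hyp_coeff assms)
  ultimately have "D = a * (1 - a) * hyF a x" by (rule sums_unique2)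
  with D(1) show ?thesis by simp
qed

lemma hyF_sl_solution:
  assumes "0 < a" "a < 1"
  shows "sl_solution (\<lambda>x. x * (1 - x)) (\<lambda>_. a * (1 - a)) (hyF a) (hyF' a)"
  unfolding sl_solution_def using hyF_has_derivative[OF assms] hyF_ode[OF assms] by auto

subsection \<open>The logarithmic solution\<close>

text \<open>This is 2 Psi(1 + n) - Psi(a + n) - Psi(1 - a + n). The sum is minus the logarithmic
  derivative of the n-th Frobenius coefficient with respect to the exponent, taken at exponent 0;
  the initial value \<open>R_fun a\<close> fixes the multiple of \<open>hyF a\<close> that is
  added.\<close>

definition log_coeff :: "real \<Rightarrow> nat \<Rightarrow> real" where
  "log_coeff a n = R_fun a + (\<Sum>k<n. 2 / (1 + real k) - 1 / (a + real k) - 1 / (1 - a + real k))"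

text \<open>The analytic part of the Frobenius solution that is logarithmic at 0.\<close>

definition log_part :: "real \<Rightarrow> real \<Rightarrow> real" where
  "log_part a x = (\<Sum>n. log_coeff a n * hyp_coeff a n * x ^ n)"

definition log_part' :: "real \<Rightarrow> real \<Rightarrow> real" where
  "log_part' a x = (\<Sum>n. diffs (\<lambda>n. log_coeff a n * hyp_coeff a n) n * x ^ n)"

text \<open>The logarithms in the three Digamma limits cancel, and \<open>R_fun a\<close> cancels
  what remains. This choice of the initial value makes the modulus vanish at 1.\<close>

lemma log_coeff_tendsto_0:
  assumes "0 < a" "a < 1"
  shows "log_coeff a \<longlonglongrightarrow> 0"
proof -
  have "(\<lambda>m. R_fun a + (- 2 * (ln (real m) - (\<Sum>k<m. inverse (1 + real k)))
            + (ln (real m) - (\<Sum>k<m. inverse (a + real k)))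
            + (ln (real m) - (\<Sum>k<m. inverse (1 - a + real k)))))
        \<longlonglongrightarrow> R_fun a + (- 2 * Digamma 1 + Digamma a + Digamma (1 - a))"
    using Digamma_LIMSEQ[of "1::real"] Digamma_LIMSEQ[of a] Digamma_LIMSEQ[of "1 - a"] assms
    by (intro tendsto_intros) auto
  moreover have "R_fun a + (- 2 * Digamma 1 + Digamma a + Digamma (1 - a)) = 0"
    by (simp add: R_fun_def)
  moreover have "(\<lambda>m. R_fun a + (- 2 * (ln (real m) - (\<Sum>k<m. inverse (1 + real k)))
            + (ln (real m) - (\<Sum>k<m. inverse (a + real k)))
            + (ln (real m) - (\<Sum>k<m. inverse (1 - a + real k))))) = log_coeff a"
    by (rule ext)
       (simp add: log_coeff_def sum_subtractf sum.distrib sum_distrib_left[symmetric] divide_inverse algebra_simps)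
  ultimately show ?thesis by simp
qed

lemma log_coeff_bounded:
  assumes "0 < a" "a < 1"
  obtains B where "\<And>n. \<bar>log_coeff a n * hyp_coeff a n\<bar> \<le> B"
proof -
  obtain C where C: "\<And>n. \<bar>log_coeff a n\<bar> \<le> C"
    using convergent_imp_Bseq[of "log_coeff a"] log_coeff_tendsto_0[OF assms]
    by (auto simp: convergent_def Bseq_def)
  have "\<bar>log_coeff a n * hyp_coeff a n\<bar> \<le> C * 1" for n
    unfolding abs_mult by (intro mult_mono C hyp_coeff_le_1 assms order.trans[OF abs_ge_zero C]) auto
  then show ?thesis by (rule that)
qed

lemma log_part_has_derivative:
  assumes "0 < a" "a < 1" "\<bar>x\<bar> < 1"
  shows "(log_part a has_real_derivative log_part' a x) (at x)"
proof -
  obtain B where B: "\<And>n. \<bar>log_coeff a n * hyp_coeff a n\<bar> \<le> B"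
    using log_coeff_bounded assms by blast
  from powser_hypergeometric_operator(1)[where e = "\<lambda>n. log_coeff a n * hyp_coeff a n", OF B assms(3)]
  show ?thesis by (simp add: log_part_def[abs_def] log_part'_def)
qed

text \<open>The inhomogeneous terms are those that the operator produces from
  \<open>ln x * hyF a x\<close>, so that they drop out for the difference
  \<open>hyS\<close>.\<close>

lemma log_part_ode:
  assumes "0 < a" "a < 1" "\<bar>x\<bar> < 1"
  shows "((\<lambda>x. x * (1 - x) * log_part' a x) has_real_derivative
           a * (1 - a) * log_part a x + 2 * (1 - x) * hyF' a x - hyF a x) (at x)"
proof -
  let ?e = "\<lambda>n. log_coeff a n * hyp_coeff a n"
  obtain B where B: "\<And>n. \<bar>?e n\<bar> \<le> B"
    using log_coeff_bounded assms by blast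
  from powser_hypergeometric_operator(4)[where e = ?e, OF B assms(3)]
  obtain D where D: "((\<lambda>x. x * (1 - x) * log_part' a x) has_real_derivative D) (at x)"
    "(\<lambda>n. ((real n + 1)\<^sup>2 * ?e (Suc n) - real n * (real n + 1) * ?e n) * x ^ n) sums D"
    unfolding log_part'_def by blast
  have rec: "(real n + 1)\<^sup>2 * ?e (Suc n) - real n * (real n + 1) * ?e n
      = a * (1 - a) * ?e n + 2 * diffs (hyp_coeff a) n - 2 * (real n * hyp_coeff a n) - hyp_coeff a n" for n
  proof -
    let ?c = "hyp_coeff a n" and ?c' = "hyp_coeff a (Suc n)"
    have nz: "a + real n \<noteq> 0" "1 - a + real n \<noteq> 0" "1 + real n \<noteq> 0" using assms by linarith+
    have d: "log_coeff a (Suc n) =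
        log_coeff a n + (2 / (1 + real n) - 1 / (a + real n) - 1 / (1 - a + real n))"
      by (simp add: log_coeff_def)
    have sq: "(real n + 1)\<^sup>2 * ?c' = (a + real n) * (1 - a + real n) * ?c"
      unfolding hyp_coeff_rec by (simp add: algebra_simps)
    have "(real n + 1)\<^sup>2 * ?e (Suc n) = log_coeff a n * ((real n + 1)\<^sup>2 * ?c')
        + ((real n + 1)\<^sup>2 * ?c') * (2 / (1 + real n))
        - ((real n + 1)\<^sup>2 * ?c') * (1 / (a + real n) + 1 / (1 - a + real n))"
      unfolding d by (simp add: algebra_simps)
    also have "((real n + 1)\<^sup>2 * ?c') * (2 / (1 + real n)) = 2 * diffs (hyp_coeff a) n"
      using nz(3) by (simp add: diffs_def power2_eq_square divide_simps) (simp add: algebra_simps)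
    \<comment> \<open>By the recurrence the first factor contains both denominators; clearing them
      leaves their sum 2 n + 1.\<close>
    also have "((real n + 1)\<^sup>2 * ?c') * (1 / (a + real n) + 1 / (1 - a + real n))
        = (2 * real n + 1) * ?c"
    proof -
      have "u * v * c * (1 / u + 1 / v) = (u + v) * c" if "u \<noteq> 0" "v \<noteq> 0" for u v c :: real
        using that by (simp add: field_simps)
      from this[OF nz(1,2), of ?c] show ?thesis unfolding sq by (simp add: add_ac)
    qed
    also have "log_coeff a n * ((real n + 1)\<^sup>2 * ?c') = (real n * (real n + 1) + a * (1 - a)) * ?e n"
      unfolding hyp_coeff_rec by simp
    finally show ?thesis by (simp add: algebra_simps)
  qed
  note F = powser_hypergeometric_operator[where e = "hyp_coeff a", OF hyp_coeff_le_1[OF assms(1,2)] assms(3)]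
  have "(\<lambda>n. a * (1 - a) * (?e n * x ^ n) + 2 * (diffs (hyp_coeff a) n * x ^ n)
           - 2 * (real n * hyp_coeff a n * x ^ n) - hyp_coeff a n * x ^ n) sums
        (a * (1 - a) * log_part a x + 2 * hyF' a x - 2 * (x * hyF' a x) - hyF a x)"
    unfolding hyF_eq log_part_def hyF'_def
    by (intro sums_add sums_diff sums_mult summable_sums summable_hyp_coeff assms
          summable_powser_bounded[where e = ?e, OF B] F(2,3))
  moreover have "((real n + 1)\<^sup>2 * ?e (Suc n) - real n * (real n + 1) * ?e n) * x ^ n =
      a * (1 - a) * (?e n * x ^ n) + 2 * (diffs (hyp_coeff a) n * x ^ n)
           - 2 * (real n * hyp_coeff a n * x ^ n) - hyp_coeff a n * x ^ n" for n
    unfolding rec by (simp add: algebra_simps)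
  ultimately have "D = a * (1 - a) * log_part a x + 2 * hyF' a x - 2 * (x * hyF' a x) - hyF a x"
    using D(2) by (simp add: sums_unique2)
  with D(1) show ?thesis by (simp add: algebra_simps)
qed

definition hyS :: "real \<Rightarrow> real \<Rightarrow> real" where
  "hyS a x = log_part a x - ln x * hyF a x"

definition hyS' :: "real \<Rightarrow> real \<Rightarrow> real" where
  "hyS' a x = log_part' a x - hyF a x / x - ln x * hyF' a x"

text \<open>This form isolates the logarithm and leaves only products whose derivatives and limits
  at 0 are known.\<close>

lemma hyS'_times:
  assumes "x \<noteq> 0"
  shows "x * (1 - x) * hyS' a x =
    x * (1 - x) * log_part' a x - (1 - x) * hyF a x - ln x * (x * (1 - x) * hyF' a x)"
proof -
  have "x * (1 - x) * (hyF a x / x) = (1 - x) * hyF a x" using assms by simp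
  then show ?thesis unfolding hyS'_def right_diff_distrib by (simp only: mult_ac)
qed

lemma hyS_sl_solution:
  assumes "0 < a" "a < 1"
  shows "sl_solution (\<lambda>x. x * (1 - x)) (\<lambda>_. a * (1 - a)) (hyS a) (hyS' a)"
  unfolding sl_solution_def
proof (intro ballI conjI)
  fix x :: real assume "x \<in> {0<..<1}"
  then have x: "0 < x" "x < 1" "\<bar>x\<bar> < 1" by auto
  note D = log_part_has_derivative[OF assms x(3)] hyF_has_derivative[OF assms x(3)]
    log_part_ode[OF assms x(3)] hyF_ode[OF assms x(3)]
  show "(hyS a has_real_derivative hyS' a x) (at x)"
    unfolding hyS_def[abs_def] hyS'_def
    by (rule DERIV_cong[OF DERIV_diff[OF D(1) DERIV_mult[OF DERIV_ln_divide[OF x(1)] D(2)]]])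
       (simp add: algebra_simps)
  have d: "((\<lambda>t. 1 - t) has_real_derivative - 1) (at x)"
    by (auto intro!: derivative_eq_intros)
  have "((\<lambda>t. t * (1 - t) * log_part' a t - (1 - t) * hyF a t - ln t * (t * (1 - t) * hyF' a t))
     has_real_derivative a * (1 - a) * hyS a x) (at x)"
    unfolding hyS_def
    by (rule DERIV_cong[OF DERIV_diff[OF DERIV_diff[OF D(3) DERIV_mult[OF d D(2)]]
          DERIV_mult[OF DERIV_ln_divide[OF x(1)] D(4)]]])
       (use x in \<open>simp add: algebra_simps\<close>)
  then show "((\<lambda>t. t * (1 - t) * hyS' a t) has_real_derivative a * (1 - a) * hyS a x) (at x)"
  proof (rule has_field_derivative_transform_within_open[where S = "{0<..<1}"])
    fix t :: real assume "t \<in> {0<..<1}"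
    then show "t * (1 - t) * log_part' a t - (1 - t) * hyF a t - ln t * (t * (1 - t) * hyF' a t)
       = t * (1 - t) * hyS' a t"
      by (intro hyS'_times[symmetric]) auto
  qed (use x in auto)
qed

lemma hyF_hyS_wronskian:
  assumes "0 < a" "a < 1" "x \<in> {0<..<1}"
  shows "x * (1 - x) * (hyF a x * hyS' a x - hyS a x * hyF' a x) = - 1"
proof -
  have c: "isCont (hyF a) 0" "isCont (log_part a) 0"
     "isCont (\<lambda>x. x * (1 - x) * hyF' a x) 0" "isCont (\<lambda>x. x * (1 - x) * log_part' a x) 0"
    using DERIV_isCont[OF hyF_has_derivative[OF assms(1,2), of 0]]
      DERIV_isCont[OF log_part_has_derivative[OF assms(1,2), of 0]]
      DERIV_isCont[OF hyF_ode[OF assms(1,2), of 0]]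
      DERIV_isCont[OF log_part_ode[OF assms(1,2), of 0]] by auto
  \<comment> \<open>The terms with \<open>ln x\<close> cancel in the Wronskian. The rest is
    continuous at 0, where only the last term survives and gives -1.\<close>
  let ?g = "\<lambda>x. hyF a x * (x * (1 - x) * log_part' a x) - log_part a x * (x * (1 - x) * hyF' a x)
        - (1 - x) * (hyF a x)\<^sup>2"
  have "isCont ?g 0" by (intro continuous_intros c)
  then have "(?g \<longlongrightarrow> - 1) (at 0)" by (simp add: isCont_def)
  then have "(?g \<longlongrightarrow> - 1) (at_right 0)" by (rule filterlim_mono) (simp_all add: at_le)
  moreover have "eventually (\<lambda>x::real. x \<in> {0<..<1}) (at_right 0)"
    by (rule eventually_at_right_real) simp
  then have "eventually (\<lambda>x. x * (1 - x) * (hyF a x * hyS' a x - hyS a x * hyF' a x) = ?g x) (at_right 0)"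
  proof eventually_elim
    case (elim x)
    have "x * (1 - x) * (hyF a x * hyS' a x - hyS a x * hyF' a x)
      = hyF a x * (x * (1 - x) * hyS' a x) - hyS a x * (x * (1 - x) * hyF' a x)"
      by (simp add: algebra_simps)
    also have "x * (1 - x) * hyS' a x = 
      x * (1 - x) * log_part' a x - (1 - x) * hyF a x - ln x * (x * (1 - x) * hyF' a x)"
      using elim by (intro hyS'_times) auto
    finally show ?case by (simp add: hyS_def power2_eq_square algebra_simps)
  qed
  ultimately have "((\<lambda>x. x * (1 - x) * (hyF a x * hyS' a x - hyS a x * hyF' a x)) \<longlongrightarrow> - 1) (at_right 0)"
    by (simp add: tendsto_cong)
  then show ?thesis
    by (rule sl_wronskian_limit[OF hyF_sl_solution[OF assms(1,2)] hyS_sl_solution[OF assms(1,2)] assms(3)])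
qed

lemma log_part_0: "log_part a 0 = R_fun a"
  unfolding log_part_def powser_zero by (simp add: log_coeff_def)

text \<open>The equation is invariant under x -> 1 - x, because \<open>x * (1 - x)\<close> is
  symmetric and the right-hand coefficient is constant.\<close>

lemma hyF_flip_sl_solution:
  assumes "0 < a" "a < 1"
  shows "sl_solution (\<lambda>x. x * (1 - x)) (\<lambda>_. a * (1 - a)) (\<lambda>x. hyF a (1 - x)) (\<lambda>x. - hyF' a (1 - x))"
  unfolding sl_solution_def
proof (intro ballI conjI)
  fix x :: real assume "x \<in> {0<..<1}"
  then have x: "\<bar>1 - x\<bar> < 1" by auto
  have d: "((\<lambda>x. 1 - x) has_real_derivative - 1) (at x)"
    by (auto intro!: derivative_eq_intros)
  show "((\<lambda>x. hyF a (1 - x)) has_real_derivative - hyF' a (1 - x)) (at x)"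
    using DERIV_chain2[OF hyF_has_derivative[OF assms x] d] by simp
  show "((\<lambda>t. t * (1 - t) * - hyF' a (1 - t)) has_real_derivative a * (1 - a) * hyF a (1 - x)) (at x)"
    using DERIV_minus[OF DERIV_chain2[OF hyF_ode[OF assms x] d]] by (simp add: mult_ac)
qed

subsection \<open>The modulus\<close>

lemma filterlim_one_minus_at_right_0:
  "filterlim (\<lambda>x::real. 1 - x) (at_left 1) (at_right 0)"
  by real_asymp

lemma eventually_unit_at_right_0: "eventually (\<lambda>x::real. x \<in> {0<..<1}) (at_right 0)"
  by (rule eventually_at_right_real) simp

lemma eventually_unit_at_left_1: "eventually (\<lambda>x::real. x \<in> {0<..<1}) (at_left 1)"
  by (rule eventually_at_left_real) simp

lemma hyF_tendsto_0:
  assumes "0 < a" "a < 1"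
  shows "(hyF a \<longlongrightarrow> 1) (at_right 0)"
proof -
  have "isCont (hyF a) 0" using DERIV_isCont[OF hyF_has_derivative[OF assms, of 0]] by simp
  then have "(hyF a \<longlongrightarrow> 1) (at 0)" by (simp add: isCont_def)
  then show ?thesis by (rule filterlim_mono) (simp_all add: at_le)
qed

lemma log_part_tendsto_0:
  assumes "0 < a" "a < 1"
  shows "(log_part a \<longlongrightarrow> R_fun a) (at_right 0)"
proof -
  have "isCont (log_part a) 0" using DERIV_isCont[OF log_part_has_derivative[OF assms, of 0]] by simp
  then have "(log_part a \<longlongrightarrow> R_fun a) (at 0)" by (simp add: isCont_def log_part_0)
  then show ?thesis by (rule filterlim_mono) (simp_all add: at_le)
qed

text \<open>Twice the modulus in the variable x = r^3. The quotient \<open>hyS a x / hyF a x\<close>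
  is split so that adding \<open>ln x\<close> visibly removes the singularity at 0.\<close>

definition double_modulus :: "real \<Rightarrow> real \<Rightarrow> real" where
  "double_modulus a x = log_part a x / hyF a x - ln x"

lemma double_modulus_eq:
  assumes "0 < a" "a < 1" "x \<in> {0<..<1}"
  shows "double_modulus a x = hyS a x / hyF a x"
  using hyF_ge_1[of a x] assms by (simp add: double_modulus_def hyS_def diff_divide_distrib)

text \<open>\<open>log_part a / hyF a\<close> is the average of the null sequence
  \<open>log_coeff a\<close> with weights \<open>hyp_coeff a n * y ^ n\<close>, whose total tends to
  infinity.\<close>

lemma double_modulus_tendsto_at_left_1:
  assumes "0 < a" "a < 1"
  shows "(double_modulus a \<longlongrightarrow> 0) (at_left 1)"
proof -
  have "((\<lambda>y. (\<Sum>n. log_coeff a n * hyp_coeff a n * y ^ n) / (\<Sum>n. hyp_coeff a n * y ^ n)) \<longlongrightarrow> 0) (at_left 1)"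
    using hyp_coeff_pos[OF assms] filterlim_hyF_at_left_1[OF assms] log_coeff_tendsto_0[OF assms] assms
    by (intro abelian_ratio_limit summable_hyp_coeff) (auto intro: less_imp_le simp: hyF_eq)
  then have "((\<lambda>y. log_part a y / hyF a y) \<longlongrightarrow> 0) (at_left 1)"
    by (simp add: hyF_eq log_part_def)
  moreover have "(ln \<longlongrightarrow> ln (1::real)) (at_left 1)" by (intro tendsto_ln tendsto_ident_at) auto
  ultimately have "((\<lambda>y. log_part a y / hyF a y - ln y) \<longlongrightarrow> 0 - ln 1) (at_left 1)"
    by (rule tendsto_diff)
  then show ?thesis by (simp add: double_modulus_def[abs_def])
qed

text \<open>Both \<open>hyF a (1 - x)\<close> and \<open>hyS a x\<close> are \<open>o(hyF a x)\<close> as \<open>x\<close> tends to 1, where \<open>hyF a x\<close>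
  blows up; hence the two solutions are proportional.\<close>

lemma hyF_flip_proportional:
  assumes "0 < a" "a < 1"
  obtains k where "\<And>x. x \<in> {0<..<1} \<Longrightarrow> hyF a (1 - x) = k * hyS a x"
proof -
  let ?p = "\<lambda>x::real. x * (1 - x)" and ?G = "\<lambda>x. hyF a (1 - x)" and ?G' = "\<lambda>x. - hyF' a (1 - x)"
  \<comment> \<open>The weighted Wronskian of \<open>hyF a\<close> and \<open>hyS a\<close> is -1,
    so with this \<open>k\<close> that of \<open>hyF a\<close> and
    \<open>hyF a (1 - x) - k * hyS a x\<close> is 0 and \<open>f\<close> is constant. The point 1/2
    is arbitrary.\<close>
  define k where "k = - (?p (1/2) * (hyF a (1/2) * ?G' (1/2) - ?G (1/2) * hyF' a (1/2)))"
  define f where "f = (\<lambda>x. (hyF a (1 - x) - k * hyS a x) / hyF a x)"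
  have d: "(f has_real_derivative 0) (at x)" if x: "x \<in> {0<..<1}" for x
  proof -
    have W1: "?p x * (hyF a x * ?G' x - ?G x * hyF' a x) = - k"
      using sl_wronskian_const[OF hyF_sl_solution[OF assms] hyF_flip_sl_solution[OF assms] x, of "1/2"]
      by (simp add: k_def)
    have "((\<lambda>x. hyF a (1 - x) - k * hyS a x) has_real_derivative ?G' x - k * hyS' a x) (at x)"
      using hyF_flip_sl_solution[OF assms] hyS_sl_solution[OF assms] x
      by (auto simp: sl_solution_def intro!: DERIV_diff DERIV_cmult)
    note deriv = this
    have W0: "?p x * (hyF a x * (?G' x - k * hyS' a x) - (hyF a (1 - x) - k * hyS a x) * hyF' a x) = 0"
    proof -
      have "?p x * (hyF a x * (?G' x - k * hyS' a x) - (hyF a (1 - x) - k * hyS a x) * hyF' a x)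
        = ?p x * (hyF a x * ?G' x - ?G x * hyF' a x) - k * (?p x * (hyF a x * hyS' a x - hyS a x * hyF' a x))"
        by (simp add: algebra_simps)
      then show ?thesis unfolding W1 hyF_hyS_wronskian[OF assms x] by simp
    qed
    have "(hyF a has_real_derivative hyF' a x) (at x)" "?p x \<noteq> 0" "hyF a x \<noteq> 0"
      using hyF_has_derivative[OF assms, of x] hyF_ge_1[OF assms, of x] x by auto
    from quotient_has_derivative_wronskian[OF this(1) deriv W0 this(2,3)] show ?thesis
      by (simp add: f_def)
  qed
  have "((\<lambda>x. hyF a (1 - x) / hyF a x - k * double_modulus a x) \<longlongrightarrow> 0 - k * 0) (at_left 1)"
  proof (intro tendsto_diff tendsto_mult tendsto_const double_modulus_tendsto_at_left_1[OF assms])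
    have "isCont (hyF a) (1 - 1)" using DERIV_isCont[OF hyF_has_derivative[OF assms, of 0]] by simp
    then have "isCont (\<lambda>x. hyF a (1 - x)) 1"
      by (intro isCont_o2[where g = "hyF a" and f = "\<lambda>x. 1 - x" and a = 1]) simp_all
    then have "((\<lambda>x. hyF a (1 - x)) \<longlongrightarrow> 1) (at 1)" by (simp add: isCont_def)
    then have "((\<lambda>x. hyF a (1 - x)) \<longlongrightarrow> 1) (at_left 1)" by (rule filterlim_mono) (simp_all add: at_le)
    then show "((\<lambda>x. hyF a (1 - x) / hyF a x) \<longlongrightarrow> 0) (at_left 1)"
      by (rule real_tendsto_divide_at_top) (rule filterlim_hyF_at_left_1[OF assms])
  qed
  moreover have "eventually (\<lambda>x. hyF a (1 - x) / hyF a x - k * double_modulus a x = f (1/2)) (at_left 1)"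
    using eventually_unit_at_left_1
  proof eventually_elim
    case (elim x)
    then have "hyF a (1 - x) / hyF a x - k * double_modulus a x = f x"
      by (simp add: f_def double_modulus_eq[OF assms] diff_divide_distrib)
    also have "f x = f (1/2)" by (rule DERIV_isconst3[OF zero_less_one elim _ d]) auto
    finally show ?case .
  qed
  ultimately have "((\<lambda>x::real. f (1/2)) \<longlongrightarrow> 0) (at_left 1)" by (simp add: tendsto_cong)
  then have f0: "f (1/2) = 0" by (simp add: tendsto_const_iff)
  show thesis
  proof (rule that[of k])
    fix x :: real assume x: "x \<in> {0<..<1}"
    have "f x = f (1/2)" by (rule DERIV_isconst3[OF zero_less_one x _ d]) auto
    with f0 hyF_ge_1[OF assms, of x] x show "hyF a (1 - x) = k * hyS a x" by (auto simp: f_def)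
  qed
qed

text \<open>The constant is found by dividing by -ln x as x tends to 0: \<open>hyS a x\<close>
  contributes 1, and the coefficient asymptotics give sin (pi a) / pi for the flipped
  function.\<close>

lemma hyF_flip:
  assumes "0 < a" "a < 1" "x \<in> {0<..<1}"
  shows "hyF a (1 - x) = sin (pi * a) / pi * hyS a x"
proof -
  obtain k where k: "\<And>x. x \<in> {0<..<1} \<Longrightarrow> hyF a (1 - x) = k * hyS a x"
    using hyF_flip_proportional assms(1,2) by blast
  have top: "filterlim (\<lambda>x::real. - ln x) at_top (at_right 0)" by real_asymp
  \<comment> \<open>The weights are 1/n and the averaged sequence is n times the coefficient. The
    term of index 0 is lost, so the numerator is \<open>hyF a y - 1\<close>; the missing 1 is
    restored after passing to the limit.\<close>
  have "((\<lambda>y. (\<Sum>n. (real n * hyp_coeff a n) * inverse (real n) * y ^ n) / (\<Sum>n. inverse (real n) * y ^ n))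
      \<longlongrightarrow> sin (pi * a) / pi) (at_left 1)"
  proof (rule abelian_ratio_limit)
    show "summable (\<lambda>n. inverse (real n) * y ^ n)" if "0 < y" "y < 1" for y
      using neg_ln_one_minus_sums[of y] that by (auto simp: sums_iff)
    have "eventually (\<lambda>y. - ln (1 - y) = (\<Sum>n. inverse (real n) * y ^ n)) (at_left 1)"
      using eventually_unit_at_left_1
      by eventually_elim (use neg_ln_one_minus_sums in \<open>auto simp: sums_iff\<close>)
    then show "filterlim (\<lambda>y. \<Sum>n. inverse (real n) * y ^ n) at_top (at_left 1)"
      using filterlim_neg_ln_one_minus by (rule filterlim_cong[THEN iffD1, OF refl refl])
  qed (use hyp_coeff_asymp[OF assms(1,2)] in auto)
  moreover have "eventually (\<lambda>y. (\<Sum>n. (real n * hyp_coeff a n) * inverse (real n) * y ^ n) / (\<Sum>n. inverse (real n) * y ^ n)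
      = (hyF a y - 1) / (- ln (1 - y))) (at_left 1)"
    using eventually_unit_at_left_1
  proof eventually_elim
    case (elim y)
    have "(\<lambda>n. hyp_coeff a n * y ^ n) sums hyF a y"
      unfolding hyF_eq by (rule summable_sums[OF summable_hyp_coeff]) (use assms elim in auto)
    then have S: "(\<lambda>n. hyp_coeff a (Suc n) * y ^ Suc n) sums (hyF a y - 1)"
      using sums_Suc_iff[of "\<lambda>n. hyp_coeff a n * y ^ n" "hyF a y - 1"] by simp
    have eq: "real (Suc n) * hyp_coeff a (Suc n) * inverse (real (Suc n)) * y ^ Suc n
        = hyp_coeff a (Suc n) * y ^ Suc n" for n
      by (simp add: field_simps del: of_nat_Suc power_Suc)
    from S have "(\<lambda>n. real (Suc n) * hyp_coeff a (Suc n) * inverse (real (Suc n)) * y ^ Suc n) sums (hyF a y - 1)"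
      by (simp only: eq)
    then have "(\<lambda>n. (real n * hyp_coeff a n) * inverse (real n) * y ^ n) sums (hyF a y - 1)"
      using sums_Suc_iff[of "\<lambda>n. (real n * hyp_coeff a n) * inverse (real n) * y ^ n" "hyF a y - 1"]
      by (simp del: of_nat_Suc power_Suc)
    moreover have "(\<lambda>n. inverse (real n) * y ^ n) sums (- ln (1 - y))"
      by (rule neg_ln_one_minus_sums) (use elim in auto)
    ultimately show ?case by (simp add: sums_iff)
  qed
  ultimately have "((\<lambda>y. (hyF a y - 1) / (- ln (1 - y))) \<longlongrightarrow> sin (pi * a) / pi) (at_left 1)"
    by (simp add: tendsto_cong)
  from filterlim_compose[OF this filterlim_one_minus_at_right_0]
  have "((\<lambda>x. (hyF a (1 - x) - 1) / (- ln x)) \<longlongrightarrow> sin (pi * a) / pi) (at_right 0)" by simp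
  moreover have "((\<lambda>x::real. 1 / (- ln x)) \<longlongrightarrow> 0) (at_right 0)"
    by (rule real_tendsto_divide_at_top[OF tendsto_const top])
  ultimately have "((\<lambda>x. (hyF a (1 - x) - 1) / (- ln x) + 1 / (- ln x)) \<longlongrightarrow> sin (pi * a) / pi + 0) (at_right 0)"
    by (rule tendsto_add)
  then have lim1: "((\<lambda>x. hyF a (1 - x) / (- ln x)) \<longlongrightarrow> sin (pi * a) / pi) (at_right 0)"
    by (simp add: add_divide_distrib[symmetric] diff_divide_distrib del: divide_minus_right)
  have "((\<lambda>x. k * (log_part a x / (- ln x) + hyF a x)) \<longlongrightarrow> k * (0 + 1)) (at_right 0)"
    by (intro tendsto_intros real_tendsto_divide_at_top[OF log_part_tendsto_0 top] hyF_tendsto_0 assms)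
  moreover have "eventually (\<lambda>x. k * (log_part a x / (- ln x) + hyF a x) = hyF a (1 - x) / (- ln x)) (at_right 0)"
    using eventually_unit_at_right_0
  proof eventually_elim
    case (elim x)
    have "ln x \<noteq> 0" using elim by auto
    then show ?case by (simp add: k[OF elim] hyS_def field_simps)
  qed
  ultimately have "((\<lambda>x. hyF a (1 - x) / (- ln x)) \<longlongrightarrow> k) (at_right 0)"
    by (simp add: tendsto_cong)
  with lim1 have "k = sin (pi * a) / pi" by (intro tendsto_unique[of "at_right (0::real)"]) auto
  with k assms show ?thesis by blast
qed

lemma mu_star_eq:
  assumes "0 < a" "a < 1" "r \<in> {0<..<1}"
  shows "mu_star a r = double_modulus a (r ^ 3) / 2"
proof -
  have x: "r ^ 3 \<in> {0<..<1}" using assms(3) by (auto simp: power_less_one_iff)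
  have "0 < a * pi" "a * pi < pi" using assms by auto
  then have "sin (pi * a) > 0" by (intro sin_gt_zero) (auto simp: mult_ac)
  then show ?thesis
    by (simp add: mu_star_def hyF_flip[OF assms(1,2) x] double_modulus_eq[OF assms(1,2) x])
qed

section \<open>Monotonicity, positivity and range of the modulus\<close>

lemma double_modulus_has_derivative:
  assumes "0 < a" "a < 1" "x \<in> {0<..<1}"
  shows "(double_modulus a has_real_derivative - 1 / (x * (1 - x) * (hyF a x)\<^sup>2)) (at x)"
proof (rule has_field_derivative_transform_within_open[where S = "{0<..<1}"])
  show "((\<lambda>x. hyS a x / hyF a x) has_real_derivative - 1 / (x * (1 - x) * (hyF a x)\<^sup>2)) (at x)"
  proof (rule quotient_has_derivative_wronskian)
    show "x * (1 - x) * (hyF a x * hyS' a x - hyS a x * hyF' a x) = - 1"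
      by (rule hyF_hyS_wronskian[OF assms])
    show "(hyF a has_real_derivative hyF' a x) (at x)" "(hyS a has_real_derivative hyS' a x) (at x)"
      using hyF_sl_solution[OF assms(1,2)] hyS_sl_solution[OF assms(1,2)] assms(3) by (auto simp: sl_solution_def)
  qed (use assms hyF_ge_1[OF assms(1,2), of x] in auto)
qed (use assms double_modulus_eq in auto)

lemma double_modulus_strict_antimono:
  assumes "0 < a" "a < 1" "0 < x" "x < y" "y < 1"
  shows "double_modulus a y < double_modulus a x"
proof (rule DERIV_neg_imp_decreasing[OF assms(4)])
  fix t assume "x \<le> t" "t \<le> y"
  then have t: "t \<in> {0<..<1}" using assms by auto
  have "hyF a t \<ge> 1" using hyF_ge_1[OF assms(1,2), of t] t by auto
  then have "- 1 / (t * (1 - t) * (hyF a t)\<^sup>2) < 0" using t by simp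
  with double_modulus_has_derivative[OF assms(1,2) t]
  show "\<exists>y. (double_modulus a has_real_derivative y) (at t) \<and> y < 0" by blast
qed

lemma double_modulus_pos:
  assumes "0 < a" "a < 1" "x \<in> {0<..<1}"
  shows "double_modulus a x > 0"
proof -
  \<comment> \<open>The limit at 1 only gives a weak inequality at \<open>y\<close>; a point
    strictly between \<open>x\<close> and 1 makes it strict at \<open>x\<close>.\<close>
  define y where "y = (x + 1) / 2"
  have y: "x < y" "y \<in> {0<..<1}" using assms by (auto simp: y_def)
  have "eventually (\<lambda>t. t \<in> {y<..<1}) (at_left 1)"
    by (rule eventually_at_left_real) (use y in auto)
  then have "eventually (\<lambda>t. double_modulus a t \<le> double_modulus a y) (at_left 1)"
    by eventually_elim (use y assms in \<open>auto intro!: less_imp_le double_modulus_strict_antimono\<close>)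
  with double_modulus_tendsto_at_left_1[OF assms(1,2)] have "0 \<le> double_modulus a y"
    by (intro tendsto_upperbound[of "double_modulus a" 0 "at_left 1"]) auto
  also have "\<dots> < double_modulus a x"
    using double_modulus_strict_antimono[OF assms(1,2), of x y] y assms by auto
  finally show ?thesis .
qed

lemma double_modulus_filterlim_at_right_0:
  assumes "0 < a" "a < 1"
  shows "filterlim (double_modulus a) at_top (at_right 0)"
proof -
  have top: "filterlim (\<lambda>x::real. - ln x) at_top (at_right 0)" by real_asymp
  have "((\<lambda>x. log_part a x / hyF a x) \<longlongrightarrow> R_fun a / 1) (at_right 0)"
    by (intro tendsto_divide log_part_tendsto_0 hyF_tendsto_0 assms) auto
  from filterlim_tendsto_add_at_top[OF this top] show ?thesis
    by (simp add: double_modulus_def[abs_def])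
qed

lemma double_modulus_surj:
  assumes "0 < a" "a < 1" "0 < t"
  obtains x where "x \<in> {0<..<1}" "double_modulus a x = t"
proof -
  have "eventually (\<lambda>x. double_modulus a x > t) (at_right 0)"
    using double_modulus_filterlim_at_right_0[OF assms(1,2)] by (simp add: filterlim_at_top_dense)
  then have "eventually (\<lambda>x. x \<in> {0<..<1} \<and> double_modulus a x > t) (at_right 0)"
    using eventually_unit_at_right_0 by eventually_elim blast
  from eventually_happens'[OF trivial_limit_at_right_real this]
  obtain u where u: "u \<in> {0<..<1}" "double_modulus a u > t" by blast
  have "eventually (\<lambda>x. double_modulus a x < t) (at_left 1)"
    using double_modulus_tendsto_at_left_1[OF assms(1,2)] assms(3) by (rule order_tendstoD(2))
  then have "eventually (\<lambda>x. x \<in> {0<..<1} \<and> double_modulus a x < t) (at_left 1)"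
    using eventually_unit_at_left_1 by eventually_elim blast
  from eventually_happens'[OF trivial_limit_at_left_real this]
  obtain v where v: "v \<in> {0<..<1}" "double_modulus a v < t" by blast
  have uv: "u < v"
  proof (rule ccontr)
    assume "\<not> u < v"
    then have "v < u \<or> v = u" by auto
    then show False using double_modulus_strict_antimono[OF assms(1,2), of v u] u v by auto
  qed
  have "\<exists>x\<ge>u. x \<le> v \<and> double_modulus a x = t"
  proof (rule IVT2)
    show "\<forall>x. u \<le> x \<and> x \<le> v \<longrightarrow> isCont (double_modulus a) x"
      using u v by (auto intro!: DERIV_isCont double_modulus_has_derivative assms)
  qed (use u v uv in auto)
  then obtain x where "u \<le> x" "x \<le> v" "double_modulus a x = t" by blast
  then show thesis using that[of x] u v by auto
qed

section \<open>The modulus plus the logarithm, and comparison of two parameters\<close>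

lemma double_modulus_add_ln_strict_antimono:
  assumes "0 < a" "a < 1" "0 < x" "x < y" "y < 1"
  shows "double_modulus a y + ln y < double_modulus a x + ln x"
proof (rule DERIV_neg_imp_decreasing[OF assms(4)])
  fix t assume "x \<le> t" "t \<le> y"
  then have t: "0 < t" "t < 1" "t \<in> {0<..<1}" using assms by auto
  have "hyF a t \<ge> 1" using hyF_ge_1[OF assms(1,2), of t] t by auto
  then have "1 < 1 / ((1 - t) * (hyF a t)\<^sup>2)"
    using hyF_less[OF assms(1,2) t(1,2)] t by simp
  then have "1 / t * 1 < 1 / t * (1 / ((1 - t) * (hyF a t)\<^sup>2))"
    using t by (intro mult_strict_left_mono) auto
  then have "- 1 / (t * (1 - t) * (hyF a t)\<^sup>2) + 1 / t < 0" by (simp add: mult.assoc)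
  moreover have "((\<lambda>t. double_modulus a t + ln t) has_real_derivative
     - 1 / (t * (1 - t) * (hyF a t)\<^sup>2) + 1 / t) (at t)"
    by (rule DERIV_add[OF double_modulus_has_derivative[OF assms(1,2) t(3)] DERIV_ln_divide[OF t(1)]])
  ultimately show "\<exists>y. ((\<lambda>t. double_modulus a t + ln t) has_real_derivative y) (at t) \<and> y < 0" by blast
qed

lemma double_modulus_add_ln_tendsto:
  assumes "0 < a" "a < 1"
  shows "((\<lambda>x. double_modulus a x + ln x) \<longlongrightarrow> R_fun a) (at_right 0)"
proof -
  have "((\<lambda>x. log_part a x / hyF a x) \<longlongrightarrow> R_fun a / 1) (at_right 0)"
    by (intro tendsto_divide log_part_tendsto_0 hyF_tendsto_0 assms) auto
  then show ?thesis by (simp add: double_modulus_def[abs_def])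
qed

text \<open>A larger parameter makes \<open>hyF\<close> larger and hence the derivative of the
  modulus less negative. The next two lemmas compare with the limits of the difference at 1 and at
  0.\<close>

lemma double_modulus_diff_antimono:
  assumes "0 < a" "a \<le> b" "b \<le> 1/2" "0 < x" "x \<le> y" "y < 1"
  shows "double_modulus a y - double_modulus b y \<le> double_modulus a x - double_modulus b x"
proof (rule DERIV_nonpos_imp_nonincreasing[OF assms(5)])
  fix t assume "x \<le> t" "t \<le> y"
  then have t: "t \<in> {0<..<1}" using assms by auto
  have ge: "hyF a t \<ge> 1" using hyF_ge_1[of a t] t assms by auto
  moreover have le: "hyF a t \<le> hyF b t" using hyF_mono[of a b t] t assms by auto
  ultimately have "t * (1 - t) * (hyF a t)\<^sup>2 \<le> t * (1 - t) * (hyF b t)\<^sup>2"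
    using t by (intro mult_left_mono power_mono) auto
  moreover have "0 < t * (1 - t) * (hyF a t)\<^sup>2" using t ge by simp
  ultimately have "1 / (t * (1 - t) * (hyF b t)\<^sup>2) \<le> 1 / (t * (1 - t) * (hyF a t)\<^sup>2)"
    by (intro frac_le) simp_all
  then have "- 1 / (t * (1 - t) * (hyF a t)\<^sup>2) - - 1 / (t * (1 - t) * (hyF b t)\<^sup>2) \<le> 0"
    by simp
  moreover have "((\<lambda>t. double_modulus a t - double_modulus b t) has_real_derivative
     - 1 / (t * (1 - t) * (hyF a t)\<^sup>2) - - 1 / (t * (1 - t) * (hyF b t)\<^sup>2)) (at t)"
    using assms by (intro DERIV_diff double_modulus_has_derivative t) auto
  ultimately show "\<exists>y. ((\<lambda>t. double_modulus a t - double_modulus b t) has_real_derivative y) (at t) \<and> y \<le> 0"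
    by blast
qed

lemma double_modulus_antimono_param:
  assumes "0 < a" "a \<le> b" "b \<le> 1/2" "x \<in> {0<..<1}"
  shows "double_modulus b x \<le> double_modulus a x"
proof -
  have "eventually (\<lambda>t. t \<in> {x<..<1}) (at_left 1)"
    by (rule eventually_at_left_real) (use assms in auto)
  then have "eventually (\<lambda>t. double_modulus a t - double_modulus b t \<le> double_modulus a x - double_modulus b x) (at_left 1)"
    by eventually_elim (use assms in \<open>auto intro!: double_modulus_diff_antimono\<close>)
  moreover have "((\<lambda>t. double_modulus a t - double_modulus b t) \<longlongrightarrow> 0 - 0) (at_left 1)"
    using assms by (intro tendsto_diff double_modulus_tendsto_at_left_1) auto
  ultimately have "0 \<le> double_modulus a x - double_modulus b x"
    by (intro tendsto_upperbound[of _ 0 "at_left 1"]) auto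
  then show ?thesis by simp
qed

lemma double_modulus_diff_le_R_fun:
  assumes "0 < a" "a \<le> b" "b \<le> 1/2" "x \<in> {0<..<1}"
  shows "double_modulus a x - double_modulus b x \<le> R_fun a - R_fun b"
proof -
  have "eventually (\<lambda>t. t \<in> {0<..<x}) (at_right 0)"
    by (rule eventually_at_right_real) (use assms in auto)
  \<comment> \<open>Adding \<open>ln t\<close> to both moduli does not change the difference and
    gives each of them a finite limit at 0.\<close>
  then have "eventually (\<lambda>t. double_modulus a x - double_modulus b x \<le>
      (double_modulus a t + ln t) - (double_modulus b t + ln t)) (at_right 0)"
    by eventually_elim (use assms double_modulus_diff_antimono[of a b _ x] in auto)
  moreover have "((\<lambda>t. (double_modulus a t + ln t) - (double_modulus b t + ln t)) \<longlongrightarrow> R_fun a - R_fun b) (at_right 0)"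
    using assms by (intro tendsto_diff double_modulus_add_ln_tendsto) auto
  ultimately show ?thesis
    by (intro tendsto_lowerbound[of _ "R_fun a - R_fun b" "at_right 0"]) auto
qed

text \<open>Gauss's multiplication formula for 3: splitting the harmonic sum of length 3 m by
  residues modulo 3 gives Psi(1/3) + Psi(2/3) + Psi(1) = 3 Psi(1) - 3 ln 3.\<close>

lemma R_fun_one_third: "R_fun (1/3) = ln 27"
proof -
  let ?D = "\<lambda>z m. ln (real m) - (\<Sum>n<m. inverse (z + real n))"
  have split: "(\<Sum>n<m. inverse (1/3 + real n)) + (\<Sum>n<m. inverse (2/3 + real n)) + (\<Sum>n<m. inverse (1 + real n))
      = 3 * (\<Sum>n<3 * m. inverse (1 + real n))" for m
  proof (induction m)
    case (Suc m)
    have "3 * Suc m = Suc (Suc (Suc (3 * m)))" by simp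
    then have "(\<Sum>n<3 * Suc m. inverse (1 + real n)) = (\<Sum>n<3 * m. inverse (1 + real n))
        + inverse (1 + 3 * real m) + inverse (2 + 3 * real m) + inverse (3 + 3 * real m)"
      by (simp only: sum.lessThan_Suc) (simp add: add_ac)
    moreover have "inverse (1/3 + real m) = 3 * inverse (1 + 3 * real m)"
      "inverse (2/3 + real m) = 3 * inverse (2 + 3 * real m)"
      "inverse (1 + real m) = 3 * inverse (3 + 3 * real m)"
      by (simp_all add: divide_simps)
    ultimately show ?case using Suc.IH by (simp only: sum.lessThan_Suc) (simp add: algebra_simps)
  qed simp
  have "(\<lambda>m. ?D (1/3) m + ?D (2/3) m + ?D 1 m) \<longlonglongrightarrow> Digamma (1/3) + Digamma (2/3) + Digamma (1::real)"
    using Digamma_LIMSEQ[of "1/3::real"] Digamma_LIMSEQ[of "2/3::real"] Digamma_LIMSEQ[of "1::real"]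
    by (intro tendsto_add) auto
  moreover have "(\<lambda>m. 3 * ?D 1 (3 * m) - 3 * ln 3) \<longlonglongrightarrow> 3 * Digamma 1 - 3 * ln (3::real)"
  proof (intro tendsto_diff tendsto_mult tendsto_const)
    have "filterlim (\<lambda>m::nat. 3 * m) at_top sequentially"
      by (intro filterlim_subseq) (simp add: strict_mono_def)
    from filterlim_compose[OF Digamma_LIMSEQ[of "1::real"] this]
    show "(\<lambda>m. ?D 1 (3 * m)) \<longlonglongrightarrow> Digamma 1" by simp
  qed
  moreover have "eventually (\<lambda>m. ?D (1/3) m + ?D (2/3) m + ?D 1 m = 3 * ?D 1 (3 * m) - 3 * ln 3) sequentially"
    using eventually_gt_at_top[of 0]
  proof eventually_elim
    case (elim m)
    then have "ln (real (3 * m)) = ln 3 + ln (real m)" by (simp add: ln_mult)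
    then show ?case using split[of m] by (simp only:) argo
  qed
  ultimately have "(\<lambda>m. 3 * ?D 1 (3 * m) - 3 * ln 3) \<longlonglongrightarrow> Digamma (1/3) + Digamma (2/3) + Digamma 1"
    and "(\<lambda>m. 3 * ?D 1 (3 * m) - 3 * ln 3) \<longlonglongrightarrow> 3 * Digamma 1 - 3 * ln (3::real)"
    by (simp_all add: tendsto_cong)
  then have "Digamma (1/3) + Digamma (2/3) + Digamma 1 = 3 * Digamma 1 - 3 * ln (3::real)"
    by (rule LIMSEQ_unique)
  moreover have "ln (27::real) = 3 * ln 3" using ln_realpow[of 3 3] by simp
  ultimately show ?thesis by (simp add: R_fun_def)
qed

subsection \<open>Ramanujan's cubic transformation\<close>

lemma cube_in_unit:
  fixes x :: real
  assumes "x \<in> {0<..<1}"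
  shows "x ^ 3 \<in> {0<..<1}"
  using assms power_strict_mono[of x 1 3] by auto

text \<open>The coefficients come from the substitution y(r) = 1 - ((1 - r) / (1 + 2 r))^3 in the
  equation of F(1/3, 2/3; 1; y): they are p = y (1 - y) / y' and q = (2/9) y'. The point here is
  that the other side of the cubic transformation solves the same equation.\<close>

lemma cubic_hyF_sl_solution:
  "sl_solution (\<lambda>r. r * (1 - r ^ 3) / (1 + 2 * r)\<^sup>2) (\<lambda>r. 2 * (1 - r)\<^sup>2 / (1 + 2 * r) ^ 4)
     (\<lambda>r. (1 + 2 * r) * hyF (1/3) (r ^ 3))
     (\<lambda>r. 2 * hyF (1/3) (r ^ 3) + (1 + 2 * r) * (3 * r\<^sup>2 * hyF' (1/3) (r ^ 3)))"
  unfolding sl_solution_def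
proof (intro ballI conjI)
  fix r :: real assume r: "r \<in> {0<..<1}"
  then have x: "\<bar>r ^ 3\<bar> < 1" by (auto simp: power_less_one_iff abs_if)
  have d3: "((\<lambda>r. r ^ 3) has_real_derivative 3 * r\<^sup>2) (at r)"
    by (auto intro!: derivative_eq_intros)
  have dF: "((\<lambda>r. hyF (1/3) (r ^ 3)) has_real_derivative hyF' (1/3) (r ^ 3) * (3 * r\<^sup>2)) (at r)"
    by (rule DERIV_chain2[OF hyF_has_derivative d3]) (use x in auto)
  have dw: "((\<lambda>r. 1 + 2 * r) has_real_derivative 2) (at r)"
    by (auto intro!: derivative_eq_intros)
  show "((\<lambda>r. (1 + 2 * r) * hyF (1/3) (r ^ 3)) has_real_derivative
     2 * hyF (1/3) (r ^ 3) + (1 + 2 * r) * (3 * r\<^sup>2 * hyF' (1/3) (r ^ 3))) (at r)"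
    by (rule DERIV_cong[OF DERIV_mult[OF dw dF]]) (simp add: mult_ac)
  have dpF: "((\<lambda>r. r ^ 3 * (1 - r ^ 3) * hyF' (1/3) (r ^ 3)) has_real_derivative
      (1/3 * (1 - 1/3) * hyF (1/3) (r ^ 3)) * (3 * r\<^sup>2)) (at r)"
    by (rule DERIV_chain2[OF hyF_ode d3]) (use x in auto)
  have w: "1 + 2 * r \<noteq> 0" using r by auto
  \<comment> \<open>The product of p with the derivative is written as A F + B (x (1 - x) F') with x
    = r^3, A = 2 r (1 - r^3) / (1 + 2 r)^2 and B = 3 / (1 + 2 r), because \<open>hyF_ode\<close>
    differentiates the bracket as a whole.\<close>
  have dA: "((\<lambda>r. 2 * r * (1 - r ^ 3) / (1 + 2 * r)\<^sup>2) has_real_derivative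
      (2 - 8 * r ^ 3) / (1 + 2 * r)\<^sup>2 - 8 * r * (1 - r ^ 3) / (1 + 2 * r) ^ 3) (at r)"
  proof -
    have d1: "((\<lambda>r. 2 * r * (1 - r ^ 3)) has_real_derivative 2 - 8 * r ^ 3) (at r)"
      by (rule DERIV_cong[OF DERIV_mult[OF DERIV_cmult[OF DERIV_ident] DERIV_diff[OF DERIV_const d3]]])
         (simp add: algebra_simps power2_eq_square power3_eq_cube)
    have d2: "((\<lambda>r. (1 + 2 * r)\<^sup>2) has_real_derivative 4 * (1 + 2 * r)) (at r)"
      by (rule DERIV_cong[OF DERIV_power[OF dw]]) simp
    have "(A * w\<^sup>2 - B * (4 * w)) / (w\<^sup>2 * w\<^sup>2) = A / w\<^sup>2 - 4 * B / w ^ 3" if "w \<noteq> 0" for A B w :: real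
      using that by (simp add: diff_divide_distrib power2_eq_square power3_eq_cube mult_ac)
    note * = this[OF w, of "2 - 8 * r ^ 3" "2 * r * (1 - r ^ 3)"]
    show ?thesis
      by (rule DERIV_cong[OF DERIV_divide[OF d1 d2]]) (use w * in auto)
  qed
  have dB: "((\<lambda>r. 3 / (1 + 2 * r)) has_real_derivative - 6 / (1 + 2 * r)\<^sup>2) (at r)"
    by (rule DERIV_cong[OF DERIV_divide[OF DERIV_const dw w]]) (simp add: power2_eq_square)
  have A': "(2 - 8 * r ^ 3) / (1 + 2 * r)\<^sup>2 - 8 * r * (1 - r ^ 3) / (1 + 2 * r) ^ 3 + 2 * r\<^sup>2 / (1 + 2 * r)
      = 2 * (1 - r)\<^sup>2 / (1 + 2 * r) ^ 3"
  proof -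
    have "(2 - 8 * r ^ 3) / w\<^sup>2 = (2 - 8 * r ^ 3) * w / w ^ 3" "2 * r\<^sup>2 / w = 2 * r\<^sup>2 * w\<^sup>2 / w ^ 3" if "w \<noteq> 0" for w
      using that by (simp_all add: power2_eq_square power3_eq_cube)
    note * = this[OF w]
    show ?thesis unfolding * diff_divide_distrib[symmetric] add_divide_distrib[symmetric]
      by (rule arg_cong2[of _ _ _ _ "(/)"]) (auto simp: algebra_simps power2_eq_square power3_eq_cube)
  qed
  let ?F = "hyF (1/3) (r ^ 3)" and ?F' = "hyF' (1/3) (r ^ 3)"
  note d = DERIV_add[OF DERIV_mult[OF dA dF] DERIV_mult[OF dB dpF]]
  have "((\<lambda>r. 2 * r * (1 - r ^ 3) / (1 + 2 * r)\<^sup>2 * hyF (1/3) (r ^ 3)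
        + 3 / (1 + 2 * r) * (r ^ 3 * (1 - r ^ 3) * hyF' (1/3) (r ^ 3))) has_real_derivative
     2 * (1 - r)\<^sup>2 / (1 + 2 * r) ^ 4 * ((1 + 2 * r) * ?F)) (at r)"
  proof (rule DERIV_cong[OF d])
    \<comment> \<open>The two terms with \<open>?F'\<close> cancel, and the equation for F
      contributes 2 r^2 / (1 + 2 r) times \<open>?F\<close>.\<close>
    have "((2 - 8 * r ^ 3) / (1 + 2 * r)\<^sup>2 - 8 * r * (1 - r ^ 3) / (1 + 2 * r) ^ 3) * ?F
        + ?F' * (3 * r\<^sup>2) * (2 * r * (1 - r ^ 3) / (1 + 2 * r)\<^sup>2)
        + (- 6 / (1 + 2 * r)\<^sup>2 * (r ^ 3 * (1 - r ^ 3) * ?F')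
           + 1/3 * (1 - 1/3) * ?F * (3 * r\<^sup>2) * (3 / (1 + 2 * r)))
      = ((2 - 8 * r ^ 3) / (1 + 2 * r)\<^sup>2 - 8 * r * (1 - r ^ 3) / (1 + 2 * r) ^ 3 + 2 * r\<^sup>2 / (1 + 2 * r)) * ?F"
    proof -
      have "A * f + f' * (3 * r\<^sup>2) * (2 * r * m / w\<^sup>2)
          + (- 6 / w\<^sup>2 * (r ^ 3 * m * f') + 1/3 * (1 - 1/3) * f * (3 * r\<^sup>2) * (3 / w))
        = (A + 2 * r\<^sup>2 / w) * f" for A f f' m w :: real
        by (simp add: distrib_left distrib_right power2_eq_square power3_eq_cube mult_ac)
      then show ?thesis .
    qed
    also have "\<dots> = 2 * (1 - r)\<^sup>2 / (1 + 2 * r) ^ 4 * ((1 + 2 * r) * ?F)"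
      unfolding A' using w by (simp add: power4_eq_xxxx power3_eq_cube mult_ac)
    finally show "((2 - 8 * r ^ 3) / (1 + 2 * r)\<^sup>2 - 8 * r * (1 - r ^ 3) / (1 + 2 * r) ^ 3) * ?F
        + ?F' * (3 * r\<^sup>2) * (2 * r * (1 - r ^ 3) / (1 + 2 * r)\<^sup>2)
        + (- 6 / (1 + 2 * r)\<^sup>2 * (r ^ 3 * (1 - r ^ 3) * ?F')
           + 1/3 * (1 - 1/3) * ?F * (3 * r\<^sup>2) * (3 / (1 + 2 * r)))
      = 2 * (1 - r)\<^sup>2 / (1 + 2 * r) ^ 4 * ((1 + 2 * r) * ?F)" .
  qed
  then show "((\<lambda>t. t * (1 - t ^ 3) / (1 + 2 * t)\<^sup>2 * (2 * hyF (1/3) (t ^ 3) + (1 + 2 * t) * (3 * t\<^sup>2 * hyF' (1/3) (t ^ 3))))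
     has_real_derivative 2 * (1 - r)\<^sup>2 / (1 + 2 * r) ^ 4 * ((1 + 2 * r) * hyF (1/3) (r ^ 3))) (at r)"
  proof (rule has_field_derivative_transform_within_open[where S = "{0<..<1}"])
    fix t :: real assume "t \<in> {0<..<1}"
    then have w: "1 + 2 * t \<noteq> 0" by auto
    have "t * (1 - t ^ 3) / w\<^sup>2 * (2 * F + w * (3 * t\<^sup>2 * F'))
       = 2 * t * (1 - t ^ 3) / w\<^sup>2 * F + 3 / w * (t ^ 3 * (1 - t ^ 3) * F')" if "w \<noteq> 0" for w F F'
      using that by (simp add: field_simps power2_eq_square power3_eq_cube)
    from this[OF w]
    show "2 * t * (1 - t ^ 3) / (1 + 2 * t)\<^sup>2 * hyF (1/3) (t ^ 3)
        + 3 / (1 + 2 * t) * (t ^ 3 * (1 - t ^ 3) * hyF' (1/3) (t ^ 3))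
      = t * (1 - t ^ 3) / (1 + 2 * t)\<^sup>2 * (2 * hyF (1/3) (t ^ 3) + (1 + 2 * t) * (3 * t\<^sup>2 * hyF' (1/3) (t ^ 3)))"
      by simp
  qed (use r in auto)
qed

lemma one_minus_cubic_ratio:
  fixes r :: real
  assumes "0 \<le> r"
  shows "1 - ((1 - r) / (1 + 2 * r)) ^ 3 = 9 * r * (1 + r + r\<^sup>2) / (1 + 2 * r) ^ 3"
proof -
  have "1 + 2 * r \<noteq> 0" using assms by simp
  then have "1 - ((1 - r) / (1 + 2 * r)) ^ 3 = ((1 + 2 * r) ^ 3 - (1 - r) ^ 3) / (1 + 2 * r) ^ 3"
    unfolding power_divide by (simp only: diff_divide_distrib) simp
  also have "(1 + 2 * r) ^ 3 - (1 - r) ^ 3 = 9 * r * (1 + r + r\<^sup>2)"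
    by (simp add: algebra_simps power2_eq_square power3_eq_cube)
  finally show ?thesis .
qed

text \<open>Chain rule: p times the derivative of F(y(r)) is y (1 - y) F'(y), and
  \<open>hyF_ode\<close> differentiates this to (1/3)(2/3) F(y) y'.\<close>

lemma cubic_hyF_sl_solution':
  "sl_solution (\<lambda>r. r * (1 - r ^ 3) / (1 + 2 * r)\<^sup>2) (\<lambda>r. 2 * (1 - r)\<^sup>2 / (1 + 2 * r) ^ 4)
     (\<lambda>r. hyF (1/3) (1 - ((1 - r) / (1 + 2 * r)) ^ 3))
     (\<lambda>r. hyF' (1/3) (1 - ((1 - r) / (1 + 2 * r)) ^ 3) * (9 * (1 - r)\<^sup>2 / (1 + 2 * r) ^ 4))"
  unfolding sl_solution_def
proof (intro ballI conjI)
  fix r :: real assume r: "r \<in> {0<..<1}"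
  then have w: "1 + 2 * r \<noteq> 0" by auto
  let ?y = "\<lambda>r. 1 - ((1 - r) / (1 + 2 * r)) ^ 3 :: real"
  have u: "0 < (1 - r) / (1 + 2 * r)" "(1 - r) / (1 + 2 * r) < 1" using r by auto
  have "\<bar>1 - v ^ 3\<bar> < 1" if "0 < v" "v < 1" for v :: real
    using cube_in_unit[of v] that by auto
  from this[OF u] have x: "\<bar>?y r\<bar> < 1" .
  have du: "((\<lambda>r. (1 - r) / (1 + 2 * r)) has_real_derivative - 3 / (1 + 2 * r)\<^sup>2) (at r)"
  proof -
    have dw: "((\<lambda>r. 1 + 2 * r) has_real_derivative 2) (at r)" "((\<lambda>r. 1 - r) has_real_derivative - 1) (at r)"
      by (auto intro!: derivative_eq_intros)
    show ?thesis
      by (rule DERIV_cong[OF DERIV_divide[OF dw(2,1) w]]) (simp add: power2_eq_square algebra_simps)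
  qed
  have dy: "(?y has_real_derivative 9 * (1 - r)\<^sup>2 / (1 + 2 * r) ^ 4) (at r)"
  proof (rule DERIV_cong[OF DERIV_diff[OF DERIV_const DERIV_power[OF du]]])
    have "0 - real 3 * (- 3 / w\<^sup>2 * (v / w) ^ (3 - Suc 0)) = 9 * v\<^sup>2 / w ^ 4" for v w :: real
      by (simp add: power_divide flip: power_add)
    then show "0 - real 3 * (- 3 / (1 + 2 * r)\<^sup>2 * ((1 - r) / (1 + 2 * r)) ^ (3 - Suc 0))
        = 9 * (1 - r)\<^sup>2 / (1 + 2 * r) ^ 4" .
  qed
  show "((\<lambda>r. hyF (1/3) (?y r)) has_real_derivative
     hyF' (1/3) (?y r) * (9 * (1 - r)\<^sup>2 / (1 + 2 * r) ^ 4)) (at r)"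
    by (rule DERIV_chain2[OF hyF_has_derivative dy]) (use x in auto)
  have "((\<lambda>r. ?y r * (1 - ?y r) * hyF' (1/3) (?y r)) has_real_derivative
      (1/3 * (1 - 1/3) * hyF (1/3) (?y r)) * (9 * (1 - r)\<^sup>2 / (1 + 2 * r) ^ 4)) (at r)"
    by (rule DERIV_chain2[OF hyF_ode dy]) (use x in auto)
  then have "((\<lambda>r. ?y r * (1 - ?y r) * hyF' (1/3) (?y r)) has_real_derivative
      2 * (1 - r)\<^sup>2 / (1 + 2 * r) ^ 4 * hyF (1/3) (?y r)) (at r)"
    by (rule DERIV_cong) simp
  then show "((\<lambda>t. t * (1 - t ^ 3) / (1 + 2 * t)\<^sup>2 * (hyF' (1/3) (?y t) * (9 * (1 - t)\<^sup>2 / (1 + 2 * t) ^ 4)))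
    has_real_derivative 2 * (1 - r)\<^sup>2 / (1 + 2 * r) ^ 4 * hyF (1/3) (?y r)) (at r)"
  proof (rule has_field_derivative_transform_within_open[where S = "{0<..<1}"])
    fix t :: real assume t: "t \<in> {0<..<1}"
    have "9 * t * s / w ^ 3 * (v / w) ^ 3 * F' = t * (v * s) / w\<^sup>2 * (F' * (9 * v\<^sup>2 / w ^ 4))" for s v w F'
      by (simp add: power_divide power2_eq_square power3_eq_cube power4_eq_xxxx mult_ac)
    moreover have "1 - t ^ 3 = (1 - t) * (1 + t + t\<^sup>2)"
      by (simp add: algebra_simps power2_eq_square power3_eq_cube)
    moreover have "?y t = 9 * t * (1 + t + t\<^sup>2) / (1 + 2 * t) ^ 3"
      using one_minus_cubic_ratio[of t] t by auto
    moreover have "1 - ?y t = ((1 - t) / (1 + 2 * t)) ^ 3" by simp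
    ultimately show "?y t * (1 - ?y t) * hyF' (1/3) (?y t)
       = t * (1 - t ^ 3) / (1 + 2 * t)\<^sup>2 * (hyF' (1/3) (?y t) * (9 * (1 - t)\<^sup>2 / (1 + 2 * t) ^ 4))"
      by metis
  qed (use r in auto)
qed

lemma isCont_hyF'_0:
  assumes "0 < a" "a < 1"
  shows "isCont (hyF' a) 0"
proof -
  have "summable (\<lambda>n. diffs (hyp_coeff a) n * (1 / 2) ^ n)"
    by (rule termdiff_converges[of _ 1]) (use assms summable_hyp_coeff in auto)
  from isCont_powser[OF this, of 0] show ?thesis by (simp add: hyF'_def[abs_def])
qed

text \<open>Both sides solve the same equation and, with their derivatives, have finite limits at 0,
  where p vanishes. So their Wronskian is 0 and their quotient is constant; at 0 it tends to
  1.\<close>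

lemma cubic_transformation:
  assumes r: "r \<in> {0<..<1}"
  shows "hyF (1/3) (1 - ((1 - r) / (1 + 2 * r)) ^ 3) = (1 + 2 * r) * hyF (1/3) (r ^ 3)"
proof -
  define p where "p = (\<lambda>r::real. r * (1 - r ^ 3) / (1 + 2 * r)\<^sup>2)"
  define H where "H = (\<lambda>r. (1 + 2 * r) * hyF (1/3) (r ^ 3))"
  define H' where "H' = (\<lambda>r. 2 * hyF (1/3) (r ^ 3) + (1 + 2 * r) * (3 * r\<^sup>2 * hyF' (1/3) (r ^ 3)))"
  define G where "G = (\<lambda>r. hyF (1/3) (1 - ((1 - r) / (1 + 2 * r)) ^ 3))"
  define G' where "G' = (\<lambda>r. hyF' (1/3) (1 - ((1 - r) / (1 + 2 * r)) ^ 3) * (9 * (1 - r)\<^sup>2 / (1 + 2 * r) ^ 4))"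
  note sol = cubic_hyF_sl_solution[folded p_def H_def H'_def]
    cubic_hyF_sl_solution'[folded p_def G_def G'_def]
  have cF: "isCont (hyF (1/3)) 0" "isCont (hyF' (1/3)) 0"
    using DERIV_isCont[OF hyF_has_derivative[of "1/3" 0]] isCont_hyF'_0[of "1/3"] by auto
  have x0: "((\<lambda>r::real. r ^ 3) \<longlongrightarrow> 0) (at_right 0)"
    and y0: "((\<lambda>r::real. 1 - ((1 - r) / (1 + 2 * r)) ^ 3) \<longlongrightarrow> 0) (at_right 0)"
    and p0: "(p \<longlongrightarrow> 0) (at_right 0)"
    and c0: "((\<lambda>r::real. 1 + 2 * r) \<longlongrightarrow> 1) (at_right 0)" "((\<lambda>r::real. 3 * r\<^sup>2) \<longlongrightarrow> 0) (at_right 0)"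
      "((\<lambda>r::real. 9 * (1 - r)\<^sup>2 / (1 + 2 * r) ^ 4) \<longlongrightarrow> 9) (at_right 0)"
    unfolding p_def by real_asymp+
  note lims = isCont_tendsto_compose[OF cF(1) x0, unfolded hyF_0] isCont_tendsto_compose[OF cF(2) x0]
    isCont_tendsto_compose[OF cF(1) y0, unfolded hyF_0] isCont_tendsto_compose[OF cF(2) y0]
  have H0: "(H \<longlongrightarrow> 1) (at_right 0)"
    unfolding H_def using tendsto_mult[OF c0(1) lims(1)] by simp
  have G0: "(G \<longlongrightarrow> 1) (at_right 0)"
    unfolding G_def using lims(3) by simp
  have H'0: "(H' \<longlongrightarrow> 2) (at_right 0)"
    unfolding H'_def
    using tendsto_add[OF tendsto_mult[OF tendsto_const[of 2] lims(1)]
        tendsto_mult[OF c0(1) tendsto_mult[OF c0(2) lims(2)]]] by simp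
  have G'0: "(G' \<longlongrightarrow> hyF' (1/3) 0 * 9) (at_right 0)"
    unfolding G'_def using tendsto_mult[OF lims(4) c0(3)] by simp
  have "((\<lambda>r. p r * (H r * G' r - G r * H' r)) \<longlongrightarrow> 0) (at_right 0)"
    using tendsto_mult[OF p0 tendsto_diff[OF tendsto_mult[OF H0 G'0] tendsto_mult[OF G0 H'0]]] by simp
  note W = sl_wronskian_limit[OF sol _ this]
  have Hpos: "H x > 0" if "x \<in> {0<..<1}" for x
    using that hyF_ge_1[of "1/3" "x ^ 3"] by (auto simp: H_def power_less_one_iff intro!: mult_pos_pos)
  have D: "((\<lambda>x. G x / H x) has_real_derivative 0) (at x)" if x: "x \<in> {0<..<1}" for x
  proof -
    have "p x \<noteq> 0" using x cube_in_unit[OF x] by (auto simp: p_def)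
    moreover have "(H has_real_derivative H' x) (at x)" "(G has_real_derivative G' x) (at x)"
      using sol x by (auto simp: sl_solution_def)
    ultimately show ?thesis
      using quotient_has_derivative_wronskian[of H "H' x" x G "G' x" "p x" 0] W[OF x] Hpos[OF x] by simp
  qed
  have "eventually (\<lambda>x. G x / H x = G r / H r) (at_right 0)"
    using eventually_unit_at_right_0
    by eventually_elim (rule DERIV_isconst3[OF zero_less_one _ r D])
  then have "((\<lambda>x. G x / H x) \<longlongrightarrow> G r / H r) (at_right 0)" by (rule tendsto_eventually)
  moreover have "((\<lambda>x. G x / H x) \<longlongrightarrow> 1 / 1) (at_right 0)"
    by (intro tendsto_divide G0 H0) auto
  ultimately have "G r / H r = 1 / 1" by (intro tendsto_unique[of "at_right (0::real)"]) auto
  then show ?thesis using Hpos[OF r] by (simp add: G_def H_def)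
qed

text \<open>The map r -> (1 - r) / (1 + 2 r) is an involution. The cubic transformation at r and at
  its image u gives both values of \<open>hyF\<close> in the quotient, and the factor is (1 + 2 r)
  (1 + 2 u) = 3.\<close>

lemma double_modulus_cubic:
  assumes s: "s \<in> {0<..<1}" and r: "r \<in> {0<..<1}" and rs: "s ^ 3 + r ^ 3 = 1"
  shows "double_modulus (1/3) (((1 - r) / (1 + 2 * r)) ^ 3) = 3 * double_modulus (1/3) (s ^ 3)"
proof -
  define u where "u = (1 - r) / (1 + 2 * r)"
  have u: "u \<in> {0<..<1}" using r by (auto simp: u_def)
  have w: "1 + 2 * r > 0" using r by auto
  have "1 + 2 * u = 3 / (1 + 2 * r)" "1 - u = 3 * r / (1 + 2 * r)"
    using w by (simp_all add: u_def divide_simps)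
  then have u2: "1 + 2 * u = 3 / (1 + 2 * r)" "(1 - u) / (1 + 2 * u) = r"
    using w by simp_all
  have F: "hyF (1/3) (1 - u ^ 3) = (1 + 2 * r) * hyF (1/3) (r ^ 3)"
    unfolding u_def by (rule cubic_transformation[OF r])
  have F': "hyF (1/3) (1 - r ^ 3) = 3 / (1 + 2 * r) * hyF (1/3) (u ^ 3)"
    using cubic_transformation[OF u] unfolding u2(2) by (simp only: u2(1))
  define k where "k = sin (pi * (1/3)) / pi"
  have "0 < pi * (1/3)" "pi * (1/3) < pi" by auto
  then have "k > 0" by (auto simp: k_def intro!: divide_pos_pos sin_gt_zero)
  have flip: "double_modulus (1/3) x = hyF (1/3) (1 - x) / hyF (1/3) x / k" if "x \<in> {0<..<1}" for x
    using that \<open>k > 0\<close> hyF_flip[of "1/3" x, folded k_def] double_modulus_eq[of "1/3" x] by auto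
  have s3: "s ^ 3 = 1 - r ^ 3" "1 - s ^ 3 = r ^ 3" using rs by auto
  have pos: "hyF (1/3) (u ^ 3) > 0" "hyF (1/3) (r ^ 3) > 0"
    using hyF_ge_1[of "1/3" "u ^ 3"] hyF_ge_1[of "1/3" "r ^ 3"] cube_in_unit[OF u] cube_in_unit[OF r] by auto
  have "double_modulus (1/3) (u ^ 3) = (1 + 2 * r) * hyF (1/3) (r ^ 3) / hyF (1/3) (u ^ 3) / k"
    unfolding flip[OF cube_in_unit[OF u]] F ..
  also have "\<dots> = 3 * (hyF (1/3) (r ^ 3) / (3 / (1 + 2 * r) * hyF (1/3) (u ^ 3)) / k)"
    using w pos by simp
  also have "\<dots> = 3 * double_modulus (1/3) (s ^ 3)"
    by (simp only: flip[OF cube_in_unit[OF s]] s3(2)) (simp only: s3(1) F')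
  finally show ?thesis by (simp add: u_def)
qed

section \<open>The iteration r_n and the value of its series\<close>

lemma r_seq_in_unit:
  assumes "r \<in> {0<..<1}"
  shows "r_seq r n \<in> {0<..<1}"
proof (induction n)
  case 0
  show ?case using cube_in_unit[OF assms] by auto
next
  case (Suc n)
  define t where "t = r_seq r n"
  have t: "t \<in> {0<..<1}" using Suc by (simp add: t_def)
  have u: "(1 - t) / (1 + 2 * t) \<in> {0<..<1}" using t by auto
  have "r_seq r (Suc n) = root 3 (9 * t * (1 + t + t\<^sup>2) / (1 + 2 * t) ^ 3)"
    using t by (simp add: t_def[symmetric] real_root_divide real_root_power_cancel)
  also have "\<dots> = root 3 (1 - ((1 - t) / (1 + 2 * t)) ^ 3)"
    using one_minus_cubic_ratio[of t] t by auto
  finally show ?case using cube_in_unit[OF u] by auto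
qed

lemma r_seq_Suc_cube:
  assumes "r \<in> {0<..<1}"
  shows "1 - r_seq r (Suc n) ^ 3 = ((1 - r_seq r n) / (1 + 2 * r_seq r n)) ^ 3"
proof -
  define t where "t = r_seq r n"
  have t: "t \<in> {0<..<1}" using r_seq_in_unit[OF assms] by (simp add: t_def)
  have "r_seq r (Suc n) ^ 3 = 9 * t * (1 + t + t\<^sup>2) / (1 + 2 * t) ^ 3"
    using t by (simp add: t_def[symmetric] power_divide del: power_Suc)
  also have "\<dots> = 1 - ((1 - t) / (1 + 2 * t)) ^ 3"
    using one_minus_cubic_ratio[of t] t by auto
  finally show ?thesis by (simp add: t_def)
qed

text \<open>With \<open>s\<^sub>n\<close> the conjugate modulus of \<open>r\<^sub>n\<close>, so that
  \<open>s\<^sub>n\<^sub>+\<^sub>1 = (1 - r\<^sub>n) / (1 + 2 * r\<^sub>n)\<close>, the \<open>n\<close>-th term of the series is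
  \<open>(3 * ln s\<^sub>n - ln s\<^sub>n\<^sub>+\<^sub>1) / 3 ^ n\<close>, and the sum telescopes.\<close>

lemma Sigma_sum_eq:
  assumes r: "r \<in> {0<..<1}"
  shows "Sigma_sum r = double_modulus (1/3) (r ^ 3) + ln (r ^ 3)"
proof -
  define s where "s = (\<lambda>n. root 3 (1 - r_seq r n ^ 3))"
  have s3: "s n ^ 3 + r_seq r n ^ 3 = 1" for n
    using cube_in_unit[OF r_seq_in_unit[OF r, of n]] by (simp add: s_def)
  have s_unit: "s n \<in> {0<..<1}" for n
    using cube_in_unit[OF r_seq_in_unit[OF r, of n]] by (auto simp: s_def)
  have s_Suc: "s (Suc n) = (1 - r_seq r n) / (1 + 2 * r_seq r n)" for n
    using r_seq_in_unit[OF r, of n] unfolding s_def r_seq_Suc_cube[OF r]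
    by (auto intro!: real_root_power_cancel divide_nonneg_nonneg)
  have s_0: "s 0 = r"
    using r cube_in_unit[OF r] by (auto simp: s_def real_root_power_cancel)
  have mod_s: "double_modulus (1/3) (s n ^ 3) = 3 ^ n * double_modulus (1/3) (r ^ 3)" for n
  proof (induction n)
    case (Suc n)
    show ?case
      using double_modulus_cubic[OF s_unit[of n] r_seq_in_unit[OF r] s3] Suc by (simp add: s_Suc)
  qed (simp add: s_0)
  define Q where "Q = (\<lambda>x. double_modulus (1/3) x + ln x)"
  define g where "g = (\<lambda>n. 3 * ln (s n) / 3 ^ n)"
  have term_eq: "ln ((1 + 2 * r_seq r n) * (1 + r_seq r n + (r_seq r n)\<^sup>2)) / 3 ^ n = g n - g (Suc n)" for n
  proof -
    let ?t = "r_seq r n"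
    have t: "0 < ?t" "?t < 1" using r_seq_in_unit[OF r, of n] by auto
    have "s n ^ 3 = 1 - ?t ^ 3" using s3[of n] by simp
    also have "\<dots> = (1 - ?t) * (1 + ?t + ?t\<^sup>2)"
      by (simp add: algebra_simps power2_eq_square power3_eq_cube)
    also have "\<dots> = s (Suc n) * ((1 + 2 * ?t) * (1 + ?t + ?t\<^sup>2))"
      using t by (simp add: s_Suc)
    finally have "ln (s n ^ 3) = ln (s (Suc n) * ((1 + 2 * ?t) * (1 + ?t + ?t\<^sup>2)))" by simp
    moreover have "(1 + 2 * ?t) * (1 + ?t + ?t\<^sup>2) > 0" using t by (intro mult_pos_pos add_pos_pos) auto
    ultimately have "3 * ln (s n) = ln (s (Suc n)) + ln ((1 + 2 * ?t) * (1 + ?t + ?t\<^sup>2))"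
      using s_unit[of n] s_unit[of "Suc n"] by (simp add: ln_mult_pos ln_realpow del: r_seq.simps)
    then have L: "ln ((1 + 2 * ?t) * (1 + ?t + ?t\<^sup>2)) = 3 * ln (s n) - ln (s (Suc n))" by linarith
    show ?thesis unfolding L by (simp add: g_def diff_divide_distrib)
  qed
  \<comment> \<open>The modulus at \<open>s n ^ 3\<close> grows by the factor 3 in each step, so
    after division by \<open>3 ^ n\<close> it leaves a nonzero limit of \<open>g\<close>. The
    remaining term vanishes because \<open>Q\<close> takes values between 0 and
    \<open>R_fun (1/3)\<close>.\<close>
  have g_eq: "g n = Q (s n ^ 3) * (1/3) ^ n - double_modulus (1/3) (r ^ 3)" for n
  proof -
    have "ln (s n ^ 3) = 3 * ln (s n)" using s_unit[of n] by (simp add: ln_realpow)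
    then have h: "3 * ln (s n) = Q (s n ^ 3) - 3 ^ n * double_modulus (1/3) (r ^ 3)"
      by (simp add: Q_def mod_s)
    show ?thesis unfolding g_def h by (simp add: diff_divide_distrib power_divide)
  qed
  have "(\<lambda>n. Q (s n ^ 3) * (1/3) ^ n) \<longlonglongrightarrow> 0"
  proof (rule Lim_null_comparison)
    have Q_le: "Q x \<le> R_fun (1/3)" if x: "x \<in> {0<..<1}" for x
    proof (rule tendsto_lowerbound)
      show "(Q \<longlongrightarrow> R_fun (1/3)) (at_right 0)"
        unfolding Q_def by (rule double_modulus_add_ln_tendsto) auto
      have "eventually (\<lambda>t. t \<in> {0<..<x}) (at_right 0)"
        by (rule eventually_at_right_real) (use x in auto)
      then show "eventually (\<lambda>t. Q x \<le> Q t) (at_right 0)"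
        by eventually_elim
           (use x double_modulus_add_ln_strict_antimono[of "1/3" _ x] in \<open>auto simp: Q_def intro: less_imp_le\<close>)
    qed auto
    have Q_ge: "Q x \<ge> 0" if x: "x \<in> {0<..<1}" for x
    proof (rule tendsto_upperbound)
      have "(ln \<longlongrightarrow> ln (1::real)) (at_left 1)" by (intro tendsto_ln tendsto_ident_at) auto
      from tendsto_add[OF double_modulus_tendsto_at_left_1[of "1/3"] this]
      show "(Q \<longlongrightarrow> 0) (at_left 1)" by (simp add: Q_def)
      have "eventually (\<lambda>t. t \<in> {x<..<1}) (at_left 1)"
        by (rule eventually_at_left_real) (use x in auto)
      then show "eventually (\<lambda>t. Q t \<le> Q x) (at_left 1)"
        by eventually_elim
           (use x double_modulus_add_ln_strict_antimono[of "1/3" x] in \<open>auto simp: Q_def intro: less_imp_le\<close>)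
    qed auto
    show "eventually (\<lambda>n. norm (Q (s n ^ 3) * (1/3) ^ n) \<le> R_fun (1/3) * (1/3) ^ n) sequentially"
      using Q_le Q_ge cube_in_unit[OF s_unit] by (auto simp: abs_mult intro!: always_eventually mult_right_mono)
    show "(\<lambda>n. R_fun (1/3) * (1/3) ^ n) \<longlonglongrightarrow> 0"
      by (intro tendsto_mult_right_zero LIMSEQ_power_zero) auto
  qed
  from tendsto_diff[OF this tendsto_const[of "double_modulus (1/3) (r ^ 3)"]]
  have "g \<longlonglongrightarrow> - double_modulus (1/3) (r ^ 3)" unfolding g_eq[symmetric] by simp
  from telescope_sums'[OF this]
  have "(\<lambda>n. g n - g (Suc n)) sums (g 0 + double_modulus (1/3) (r ^ 3))" by simp
  then have "Sigma_sum r = g 0 + double_modulus (1/3) (r ^ 3)"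
    unfolding Sigma_sum_def term_eq by (rule sums_unique[symmetric])
  also have "g 0 = ln (r ^ 3)" using r by (simp add: g_def s_0 ln_realpow)
  finally show ?thesis by simp
qed

subsection \<open>The lower bound\<close>

text \<open>\<open>inv_into\<close> inverts only on the image, so it is the surjectivity of the
  modulus that gives \<open>phi_star\<close> its defining property.\<close>

lemma double_modulus_phi_star:
  assumes a: "0 < a" "a < 1" and r: "r \<in> {0<..<1}" and K: "K > 0"
  shows "phi_star (1 / K) a r \<in> {0<..<1}"
    and "double_modulus a (phi_star (1 / K) a r ^ 3) = K * double_modulus a (r ^ 3)"
proof -
  have "K * double_modulus a (r ^ 3) > 0"
    using K double_modulus_pos[OF a cube_in_unit[OF r]] by simp
  then obtain x where x: "x \<in> {0<..<1}" "double_modulus a x = K * double_modulus a (r ^ 3)"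
    using double_modulus_surj[OF a] by metis
  have rx: "root 3 x \<in> {0<..<1}" "root 3 x ^ 3 = x" using x by auto
  have "mu_star a r / (1 / K) \<in> mu_star a ` {0<..<1}"
  proof (rule image_eqI)
    show "mu_star a r / (1 / K) = mu_star a (root 3 x)"
      unfolding mu_star_eq[OF a rx(1)] mu_star_eq[OF a r] rx(2) x(2) by simp
  qed (rule rx(1))
  from inv_into_into[OF this] f_inv_into_f[OF this]
  have phi: "phi_star (1 / K) a r \<in> {0<..<1}" "mu_star a (phi_star (1 / K) a r) = mu_star a r / (1 / K)"
    unfolding phi_star_def by blast+
  show "phi_star (1 / K) a r \<in> {0<..<1}" by (rule phi(1))
  show "double_modulus a (phi_star (1 / K) a r ^ 3) = K * double_modulus a (r ^ 3)"
    using phi(2) unfolding mu_star_eq[OF a phi(1)] mu_star_eq[OF a r] by simp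
qed

text \<open>Both inequalities of the theorem are instances with different \<open>C\<close>. As 1 - K
  is negative, an upper bound for the modulus plus logarithm yields a lower bound for
  \<open>phi_star\<close>.\<close>

lemma phi_star_lower_bound:
  assumes a: "0 < a" "a < 1" and r: "r \<in> {0<..<1}" and K: "K > 1"
    and C: "double_modulus a (r ^ 3) + ln (r ^ 3) \<le> C"
  shows "phi_star (1 / K) a r > r powr K * exp ((1 - K) / 3 * C)"
proof -
  define s where "s = phi_star (1 / K) a r"
  have s: "s \<in> {0<..<1}" "double_modulus a (s ^ 3) = K * double_modulus a (r ^ 3)"
    using double_modulus_phi_star[OF a r] K by (auto simp: s_def)
  have x: "r ^ 3 \<in> {0<..<1}" "s ^ 3 \<in> {0<..<1}" using cube_in_unit r s(1) by blast+
  have "double_modulus a (r ^ 3) < double_modulus a (s ^ 3)"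
    using K double_modulus_pos[OF a x(1)] by (simp add: s(2))
  then have "s ^ 3 < r ^ 3"
    using double_modulus_strict_antimono[OF a, of "r ^ 3" "s ^ 3"] x
    by (cases "s ^ 3" "r ^ 3" rule: linorder_cases) auto
  then have "double_modulus a (r ^ 3) + ln (r ^ 3) < double_modulus a (s ^ 3) + ln (s ^ 3)"
    using x by (intro double_modulus_add_ln_strict_antimono a) auto
  \<comment> \<open>The modulus at \<open>s ^ 3\<close> is replaced by \<open>K\<close> times the
    modulus at \<open>r ^ 3\<close>, and the result is regrouped around the modulus plus logarithm
    at \<open>r ^ 3\<close>.\<close>
  then have "ln (s ^ 3) > K * ln (r ^ 3) + (1 - K) * (double_modulus a (r ^ 3) + ln (r ^ 3))"
    unfolding s(2) by (simp add: algebra_simps)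
  moreover have "(1 - K) * (double_modulus a (r ^ 3) + ln (r ^ 3)) \<ge> (1 - K) * C"
    using K C by (intro mult_left_mono_neg) auto
  ultimately have "ln (s ^ 3) > K * ln (r ^ 3) + (1 - K) * C" by linarith
  moreover have "ln (s ^ 3) = 3 * ln s" "ln (r ^ 3) = 3 * ln r"
    using s r by (simp_all add: ln_realpow)
  ultimately have "K * ln r + (1 - K) / 3 * C < ln s" by (simp add: field_simps)
  then have "exp (K * ln r + (1 - K) / 3 * C) < exp (ln s)" by simp
  then show ?thesis using s r by (simp add: s_def[symmetric] powr_def exp_add)
qed

theorem corollary1p3:
  fixes a r K :: real
  assumes "0 < a" and "a \<le> 1/2"
    and "0 < r" and "r < 1"
    and "1 < K"
  shows "(a \<le> 1/3 \<longrightarrow>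
            phi_star (1 / K) a r >
              r powr K * exp ((1 - K) / 3 * (R_fun a - ln 27 + Sigma_sum r))) \<and>
         (1/3 \<le> a \<and> a < 1/2 \<longrightarrow>
            phi_star (1 / K) a r > r powr K * exp (Sigma_sum r * (1 - K) / 3))"
proof (intro conjI impI)
  have r: "r \<in> {0<..<1}" using assms by auto
  note bound = phi_star_lower_bound[OF assms(1) _ r assms(5)]
  have Sigma: "Sigma_sum r = double_modulus (1/3) (r ^ 3) + ln (r ^ 3)"
    by (rule Sigma_sum_eq[OF r])
  show "phi_star (1 / K) a r > r powr K * exp ((1 - K) / 3 * (R_fun a - ln 27 + Sigma_sum r))"
    if "a \<le> 1/3"
    \<comment> \<open>The number \<open>ln 27\<close> enters as \<open>R_fun (1/3)\<close>, the
      limit at 0 for the reference parameter 1/3.\<close>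
    using double_modulus_diff_le_R_fun[of a "1/3" "r ^ 3"] cube_in_unit[OF r] assms that
    by (intro bound) (auto simp: Sigma R_fun_one_third)
  have "phi_star (1 / K) a r > r powr K * exp ((1 - K) / 3 * Sigma_sum r)"
    if "1/3 \<le> a \<and> a < 1/2"
    using double_modulus_antimono_param[of "1/3" a "r ^ 3"] cube_in_unit[OF r] assms that
    by (intro bound) (auto simp: Sigma)
  then show "phi_star (1 / K) a r > r powr K * exp (Sigma_sum r * (1 - K) / 3)"
    if "1/3 \<le> a \<and> a < 1/2"
    using that by (simp add: mult.commute)
qed

end
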